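(* Let $(\nu_0,\mu_0)=(0,0)$ or $(\frac12,\frac12)$. Let $\rho$ be the representation of $\mathfrak{g}=\mathfrak{so}(3,2)$ on the span of $\{\hat{\mathcal{S}}_\nu^\mu=\hat{\mathcal{S}}_{\nu_0+n}^{\mu_0+m}\}$, $(n,m)\in\mathbb{Z}^2$, obtained from the action formulas for $J_\pm,K_\pm,R_\pm,S_\pm,J_3,K_3$ in the context by identifying $\mathfrak{so}(3,2)$ with the real span of $${\rm i}J_1,{\rm i}J_2,{\rm i}J_3;\quad{\rm i}PC_1^+,{\rm i}PC_2^+,{\rm i}PC_3^+;\quad PC_1^-,PC_2^-,PC_3^-;\quad{\rm i}D.$$ Then $\rho$ has an irreducible constituent that is defined on the subspace spanned by the $\hat{\mathcal{S}}_\nu^\mu$ with $\nu=\nu_0+n$, $n=0,1,2,\dots$, and $\mu=-\nu,-\nu+1,\dots,\nu-1,\nu$ (the representation restricts to this subspace). On this subspace, every element of $\mathfrak{g}$ is represented, in the basis of these $\hat{\mathcal{S}}_\nu^\mu$, by an infinite matrix that is skew-Hermitian.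
   Context: The basis elements are formally $$\hat{\mathcal{S}}_\nu^\mu(r,\theta,\varphi)=\sqrt{\frac{\Gamma(\nu-\mu+1)}{\Gamma(\nu+\mu+1)}}\;r^\nu\,{\rm P}_\nu^\mu(\cos\theta)\,{\rm e}^{{\rm i}\mu\varphi},$$ ${\rm P}_\nu^\mu$ being the Ferrers function of the first kind; for the indices of the stated subspace the quantity under the square root is finite and positive, and the positive root is taken. The action of the ladder and labeling operators on this family is given by $$J_\pm\hat{\mathcal{S}}_\nu^\mu=\sqrt{(\nu-\mu+\tfrac12\mp\tfrac12)(\nu+\mu+\tfrac12\pm\tfrac12)}\;\hat{\mathcal{S}}_\nu^{\mu\pm1},$$ $$K_\pm\hat{\mathcal{S}}_\nu^\mu=\sqrt{(\nu-\mu+\tfrac12\pm\tfrac12)(\nu+\mu+\tfrac12\pm\tfrac12)}\;\hat{\mathcal{S}}_{\nu\pm1}^\mu,$$ $$R_\pm\hat{\mathcal{S}}_\nu^\mu=\sqrt{(\nu+\mu+\tfrac12\pm\tfrac12)(\nu+\mu+\tfrac12\pm\tfrac32)}\;\hat{\mathcal{S}}_{\nu\pm1}^{\mu\pm1},$$ $$S_\pm\hat{\mathcal{S}}_\nu^\mu=\sqrt{(\nu-\mu+\tfrac12\pm\tfrac12)(\nu-\mu+\tfrac12\pm\tfrac32)}\;\hat{\mathcal{S}}_{\nu\pm1}^{\mu\mp1},$$ $$J_3\hat{\mathcal{S}}_\nu^\mu=\mu\,\hat{\mathcal{S}}_\nu^\mu,\qquad K_3\hat{\mathcal{S}}_\nu^\mu=(\nu+\tfrac12)\,\hat{\mathcal{S}}_\nu^\mu.$$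 (On the stated subspace all quantities under the roots are nonnegative, and nonnegative roots are taken.) Further, $$J_1=\tfrac12(J_++J_-),\quad J_2=-\tfrac{\rm i}2(J_+-J_-),\quad D=K_3,$$ $$PC_1^\pm=\tfrac14(\mp R_+-R_-\pm S_++S_-),\quad PC_2^\pm=-\tfrac{\rm i}4(\mp R_++R_-\mp S_++S_-),\quad PC_3^\pm=\tfrac12(\pm K_++K_-).$$ The real span in the claim is isomorphic to $\mathfrak{so}(3,2)$ via the skew-symmetric array with ${\bf M}_{1,i+1}=-PC_i^-$ and ${\bf M}_{i+1,5}=-{\rm i}PC_i^+$ ($i=1,2,3$), ${\bf M}_{15}=-{\rm i}D$, ${\bf M}_{23}=-{\rm i}J_3$, ${\bf M}_{24}={\rm i}J_2$, ${\bf M}_{34}=-{\rm i}J_1$, and $\Gamma=(g_{ab})={\rm diag}(+1,-1,-1,-1,+1)$, where $[{\bf M}_{ab},{\bf M}_{cd}]=g_{ad}{\bf M}_{bc}+g_{bc}{\bf M}_{ad}-g_{ac}{\bf M}_{bd}-g_{bd}{\bf M}_{ac}$. Spans carrying the representation are complex linear spans. *)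

theory Defs
  imports "HOL-Analysis.Analysis" "HOL-Library.Poly_Mapping"
begin

subsection \<open>The formal span of the basis elements\<close>

text \<open>
  For indices outside the region \<open>-\<nu> \<le> \<mu> \<le> \<nu>\<close> the normalisation of the basis elements is only
  formal (the Gamma quotient may have poles).  The complex span of the whole family is therefore
  the free complex vector space on \<open>\<int>\<^sup>2\<close>, the basis vector \<open>bas (n, m)\<close> standing for the basis
  element with indices \<open>\<nu> = \<nu>0 + n\<close>, \<open>\<mu> = \<mu>0 + m\<close>.
\<close>

type_synonym fvec = "(int \<times> int) \<Rightarrow>\<^sub>0 complex"

definition scl :: "complex \<Rightarrow> fvec \<Rightarrow> fvec"  (infixr "\<odot>" 75)
  where "a \<odot> v = Poly_Mapping.map ((*) a) v"

lemma lookup_scl [simp]: "Poly_Mapping.lookup (a \<odot> v) k = a * Poly_Mapping.lookup v k"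
  by (simp add: scl_def Poly_Mapping.map.rep_eq when_def)

interpretation fs: vector_space scl
  by unfold_locales (auto intro!: poly_mapping_eqI simp: lookup_add algebra_simps)

definition bas :: "int \<times> int \<Rightarrow> fvec"
  where "bas k = Poly_Mapping.single k 1"

definition lin_ext :: "(int \<times> int \<Rightarrow> fvec) \<Rightarrow> fvec \<Rightarrow> fvec"
  where "lin_ext f v = (\<Sum>k\<in>Poly_Mapping.keys v. Poly_Mapping.lookup v k \<odot> f k)"


subsection \<open>The functions realising the basis elements on the stated subspace\<close>

text \<open>
  Ferrers function of the first kind on \<open>(-1, 1)\<close>, through the regularised hypergeometric series
  \<open>F(\<nu>+1, -\<nu>; 1-\<mu>; (1-x)/2) / \<Gamma>(1-\<mu>)\<close>, which is meaningful for every real \<open>\<mu>\<close>.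
\<close>

definition ferrersP :: "real \<Rightarrow> real \<Rightarrow> real \<Rightarrow> real"
  where "ferrersP \<nu> \<mu> x =
    ((1 + x) / (1 - x)) powr (\<mu> / 2) *
    suminf (\<lambda>k. pochhammer (\<nu> + 1) k * pochhammer (- \<nu>) k * rGamma (1 - \<mu> + real k) / fact k
           * ((1 - x) / 2) ^ k)"

definition Shat :: "real \<Rightarrow> real \<Rightarrow> real \<Rightarrow> real \<Rightarrow> real \<Rightarrow> complex"
  where "Shat \<nu> \<mu> r \<theta> \<phi> =
    of_real (sqrt (Gamma (\<nu> - \<mu> + 1) / Gamma (\<nu> + \<mu> + 1)) * r powr \<nu> * ferrersP \<nu> \<mu> (cos \<theta>))
    * exp (\<i> * of_real (\<mu> * \<phi>))"

text \<open>
  The function named by a formal vector.  Only vectors supported on \<open>sub_index\<close> below are meant: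
  elsewhere \<open>Shat\<close> is affected by the convention that \<open>Gamma\<close> is 0 at its poles.  On that index set,
  injectivity of \<open>realise\<close> (on \<open>r > 0\<close>, \<open>0 < \<theta> < \<pi>\<close>) says that the functions \<open>Shat\<close> are a basis of
  their span, so that formal vectors and functions may be identified.
\<close>

definition realise :: "real \<Rightarrow> real \<Rightarrow> fvec \<Rightarrow> real \<Rightarrow> real \<Rightarrow> real \<Rightarrow> complex"
  where "realise \<nu>0 \<mu>0 v r \<theta> \<phi> =
    (\<Sum>(n, m)\<in>Poly_Mapping.keys v.
       Poly_Mapping.lookup v (n, m) * Shat (\<nu>0 + of_int n) (\<mu>0 + of_int m) r \<theta> \<phi>)"

text \<open>Indices \<open>\<nu> = \<nu>0 + n\<close>, \<open>n = 0, 1, 2, \<dots>\<close>, and \<open>\<mu> = -\<nu>, -\<nu> + 1, \<dots>, \<nu>\<close>.\<close>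

definition sub_index :: "real \<Rightarrow> real \<Rightarrow> (int \<times> int) set"
  where "sub_index \<nu>0 \<mu>0 =
    {(n, m). n \<ge> 0 \<and> (\<exists>j::nat. \<mu>0 + of_int m = - (\<nu>0 + of_int n) + real j)
                   \<and> \<mu>0 + of_int m \<le> \<nu>0 + of_int n}"

definition sub_space :: "real \<Rightarrow> real \<Rightarrow> fvec set"
  where "sub_space \<nu>0 \<mu>0 = fs.span (bas ` sub_index \<nu>0 \<mu>0)"


subsection \<open>Ladder and labeling operators\<close>

text \<open>
  The operators \<open>J\<^sub>\<plusminus>, K\<^sub>\<plusminus>, R\<^sub>\<plusminus>, S\<^sub>\<plusminus>\<close> are indexed by their letter and by a sign \<open>s \<in> {1, -1}\<close>.
\<close>

datatype ladder = LJ | LK | LR | LS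

fun radicand :: "ladder \<Rightarrow> int \<Rightarrow> real \<Rightarrow> real \<Rightarrow> real"
  where
    "radicand LJ s \<nu> \<mu> = (\<nu> - \<mu> + 1/2 - of_int s * (1/2)) * (\<nu> + \<mu> + 1/2 + of_int s * (1/2))"
  | "radicand LK s \<nu> \<mu> = (\<nu> - \<mu> + 1/2 + of_int s * (1/2)) * (\<nu> + \<mu> + 1/2 + of_int s * (1/2))"
  | "radicand LR s \<nu> \<mu> = (\<nu> + \<mu> + 1/2 + of_int s * (1/2)) * (\<nu> + \<mu> + 1/2 + of_int s * (3/2))"
  | "radicand LS s \<nu> \<mu> = (\<nu> - \<mu> + 1/2 + of_int s * (1/2)) * (\<nu> - \<mu> + 1/2 + of_int s * (3/2))"

fun target :: "ladder \<Rightarrow> int \<Rightarrow> int \<times> int \<Rightarrow> int \<times> int"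
  where
    "target LJ s (n, m) = (n, m + s)"
  | "target LK s (n, m) = (n + s, m)"
  | "target LR s (n, m) = (n + s, m + s)"
  | "target LS s (n, m) = (n + s, m - s)"

text \<open>
  Off the stated subspace a radicand can be negative and the choice of its square root has to be
  made coherently: taking the principal root of every radicand does \<^emph>\<open>not\<close> give a representation,
  whereas multiplying the principal roots of the two factors does.  A family of coefficients is
  called admissible if it consists of square roots of the radicands, and of their nonnegative roots
  on the stated subspace.
\<close>

type_synonym roots = "ladder \<Rightarrow> int \<Rightarrow> int \<times> int \<Rightarrow> complex"

definition admissible_roots :: "real \<Rightarrow> real \<Rightarrow> roots \<Rightarrow> bool"
  where "admissible_roots \<nu>0 \<mu>0 c \<longleftrightarrow>
    (\<forall>L. \<forall>s\<in>{1, -1}. \<forall>n m.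
       (c L s (n, m))\<^sup>2 = of_real (radicand L s (\<nu>0 + of_int n) (\<mu>0 + of_int m)) \<and>
       ((n, m) \<in> sub_index \<nu>0 \<mu>0 \<longrightarrow>
          c L s (n, m) = of_real (sqrt (radicand L s (\<nu>0 + of_int n) (\<mu>0 + of_int m)))))"

definition ladder_op :: "roots \<Rightarrow> ladder \<Rightarrow> int \<Rightarrow> fvec \<Rightarrow> fvec"
  where "ladder_op c L s = lin_ext (\<lambda>k. c L s k \<odot> bas (target L s k))"

definition J3 :: "real \<Rightarrow> fvec \<Rightarrow> fvec"
  where "J3 \<mu>0 = lin_ext (\<lambda>(n, m). of_real (\<mu>0 + of_int m) \<odot> bas (n, m))"

definition K3 :: "real \<Rightarrow> fvec \<Rightarrow> fvec"
  where "K3 \<nu>0 = lin_ext (\<lambda>(n, m). of_real (\<nu>0 + of_int n + 1/2) \<odot> bas (n, m))"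

definition J1 :: "roots \<Rightarrow> fvec \<Rightarrow> fvec"
  where "J1 c v = (1/2) \<odot> (ladder_op c LJ 1 v + ladder_op c LJ (-1) v)"

definition J2 :: "roots \<Rightarrow> fvec \<Rightarrow> fvec"
  where "J2 c v = (- \<i>/2) \<odot> (ladder_op c LJ 1 v - ladder_op c LJ (-1) v)"

definition PC1 :: "roots \<Rightarrow> int \<Rightarrow> fvec \<Rightarrow> fvec"
  where "PC1 c s v = (1/4) \<odot> (of_int (- s) \<odot> ladder_op c LR 1 v - ladder_op c LR (-1) v
                              + of_int s \<odot> ladder_op c LS 1 v + ladder_op c LS (-1) v)"

definition PC2 :: "roots \<Rightarrow> int \<Rightarrow> fvec \<Rightarrow> fvec"
  where "PC2 c s v = (- \<i>/4) \<odot> (of_int (- s) \<odot> ladder_op c LR 1 v + ladder_op c LR (-1) v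
                              + of_int (- s) \<odot> ladder_op c LS 1 v + ladder_op c LS (-1) v)"

definition PC3 :: "roots \<Rightarrow> int \<Rightarrow> fvec \<Rightarrow> fvec"
  where "PC3 c s v = (1/2) \<odot> (of_int s \<odot> ladder_op c LK 1 v + ladder_op c LK (-1) v)"

abbreviation Dop :: "real \<Rightarrow> fvec \<Rightarrow> fvec"
  where "Dop \<equiv> K3"

definition real_span :: "(fvec \<Rightarrow> fvec) list \<Rightarrow> (fvec \<Rightarrow> fvec) set"
  where "real_span Ts = {T. \<exists>x :: nat \<Rightarrow> real. T = (\<lambda>v. \<Sum>k<length Ts. of_real (x k) \<odot> (Ts ! k) v)}"

definition generators :: "real \<Rightarrow> real \<Rightarrow> roots \<Rightarrow> (fvec \<Rightarrow> fvec) list"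
  where "generators \<nu>0 \<mu>0 c =
    [\<lambda>v. \<i> \<odot> J1 c v, \<lambda>v. \<i> \<odot> J2 c v, \<lambda>v. \<i> \<odot> J3 \<mu>0 v,
     \<lambda>v. \<i> \<odot> PC1 c 1 v, \<lambda>v. \<i> \<odot> PC2 c 1 v, \<lambda>v. \<i> \<odot> PC3 c 1 v,
     PC1 c (-1), PC2 c (-1), PC3 c (-1),
     \<lambda>v. \<i> \<odot> Dop \<nu>0 v]"


subsection \<open>The Lie algebra and its identification with the real span\<close>

text \<open>
  In the numeral type \<open>5\<close> the indices \<open>1, \<dots>, 5\<close> are pairwise distinct and exhaust the type
  (with \<open>5 = 0\<close>).
\<close>

definition metric :: "real ^ 5 ^ 5"
  where "metric = (\<chi> a b. if a = b then (if a = 1 \<or> a = 5 then 1 else - 1) else 0)"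

definition so32 :: "(real ^ 5 ^ 5) set"
  where "so32 = {X. transpose X ** metric + metric ** X = 0}"

definition upperM :: "real \<Rightarrow> real \<Rightarrow> roots \<Rightarrow> 5 \<Rightarrow> 5 \<Rightarrow> fvec \<Rightarrow> fvec"
  where "upperM \<nu>0 \<mu>0 c a b v =
    (if a = 1 \<and> b = 2 then - PC1 c (-1) v
     else if a = 1 \<and> b = 3 then - PC2 c (-1) v
     else if a = 1 \<and> b = 4 then - PC3 c (-1) v
     else if a = 2 \<and> b = 5 then (- \<i>) \<odot> PC1 c 1 v
     else if a = 3 \<and> b = 5 then (- \<i>) \<odot> PC2 c 1 v
     else if a = 4 \<and> b = 5 then (- \<i>) \<odot> PC3 c 1 v
     else if a = 1 \<and> b = 5 then (- \<i>) \<odot> Dop \<nu>0 v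
     else if a = 2 \<and> b = 3 then (- \<i>) \<odot> J3 \<mu>0 v
     else if a = 2 \<and> b = 4 then \<i> \<odot> J2 c v
     else if a = 3 \<and> b = 4 then (- \<i>) \<odot> J1 c v
     else 0)"

definition skewM :: "real \<Rightarrow> real \<Rightarrow> roots \<Rightarrow> 5 \<Rightarrow> 5 \<Rightarrow> fvec \<Rightarrow> fvec"
  where "skewM \<nu>0 \<mu>0 c a b v = upperM \<nu>0 \<mu>0 c a b v - upperM \<nu>0 \<mu>0 c b a v"

text \<open>
  The matrices \<open>X\<^sub>a\<^sub>b = e\<^sub>a (g e\<^sub>b)\<^sup>T - e\<^sub>b (g e\<^sub>a)\<^sup>T\<close> with \<open>a < b\<close> form a basis of \<open>so32\<close> and satisfy
  \<open>[X\<^sub>a\<^sub>b, X\<^sub>c\<^sub>d] = g\<^sub>a\<^sub>d X\<^sub>b\<^sub>c + g\<^sub>b\<^sub>c X\<^sub>a\<^sub>d - g\<^sub>a\<^sub>c X\<^sub>b\<^sub>d - g\<^sub>b\<^sub>d X\<^sub>a\<^sub>c\<close>; the coordinate of \<open>X\<close> along \<open>X\<^sub>a\<^sub>b\<close> is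
  \<open>X $ a $ b * g\<^sub>b\<^sub>b\<close>.  So \<open>rho\<close> is the real-linear map sending \<open>X\<^sub>a\<^sub>b\<close> to the \<open>(a, b)\<close> entry of the
  skew-symmetric array of operators (the factor 1/2 compensates for summing over all pairs).
\<close>

definition rho :: "real \<Rightarrow> real \<Rightarrow> roots \<Rightarrow> real ^ 5 ^ 5 \<Rightarrow> fvec \<Rightarrow> fvec"
  where "rho \<nu>0 \<mu>0 c X v =
    (\<Sum>a\<in>UNIV. \<Sum>b\<in>UNIV. of_real (1/2 * X $ a $ b * metric $ b $ b) \<odot> skewM \<nu>0 \<mu>0 c a b v)"


subsection \<open>Representations, irreducibility, matrices\<close>

definition lie_rep :: "(real ^ 'n ^ 'n) set \<Rightarrow> (real ^ 'n ^ 'n \<Rightarrow> fvec \<Rightarrow> fvec) \<Rightarrow> bool"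
  where "lie_rep \<g> \<rho> \<longleftrightarrow>
    (\<forall>X\<in>\<g>. Vector_Spaces.linear scl scl (\<rho> X)) \<and>
    (\<forall>X\<in>\<g>. \<forall>Y\<in>\<g>. \<forall>v. \<rho> (X + Y) v = \<rho> X v + \<rho> Y v) \<and>
    (\<forall>X\<in>\<g>. \<forall>x. \<forall>v. \<rho> (x *\<^sub>R X) v = of_real x \<odot> \<rho> X v) \<and>
    (\<forall>X\<in>\<g>. \<forall>Y\<in>\<g>. \<forall>v. \<rho> (X ** Y - Y ** X) v = \<rho> X (\<rho> Y v) - \<rho> Y (\<rho> X v))"

definition invariant_subspace ::
    "(real ^ 'n ^ 'n) set \<Rightarrow> (real ^ 'n ^ 'n \<Rightarrow> fvec \<Rightarrow> fvec) \<Rightarrow> fvec set \<Rightarrow> bool"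
  where "invariant_subspace \<g> \<rho> W \<longleftrightarrow> fs.subspace W \<and> (\<forall>X\<in>\<g>. \<forall>v\<in>W. \<rho> X v \<in> W)"

definition irreducible_subrep ::
    "(real ^ 'n ^ 'n) set \<Rightarrow> (real ^ 'n ^ 'n \<Rightarrow> fvec \<Rightarrow> fvec) \<Rightarrow> fvec set \<Rightarrow> bool"
  where "irreducible_subrep \<g> \<rho> W \<longleftrightarrow>
    invariant_subspace \<g> \<rho> W \<and> W \<noteq> {0} \<and>
    (\<forall>U. invariant_subspace \<g> \<rho> U \<and> U \<subseteq> W \<longrightarrow> U = {0} \<or> U = W)"

definition mat_entry :: "(fvec \<Rightarrow> fvec) \<Rightarrow> int \<times> int \<Rightarrow> int \<times> int \<Rightarrow> complex"
  where "mat_entry T i j = Poly_Mapping.lookup (T (bas j)) i"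

definition skew_hermitian_on :: "'i set \<Rightarrow> ('i \<Rightarrow> 'i \<Rightarrow> complex) \<Rightarrow> bool"
  where "skew_hermitian_on I A \<longleftrightarrow> (\<forall>i\<in>I. \<forall>j\<in>I. A i j = - cnj (A j i))"

end

theory Submission
  imports Defs
begin

text \<open>
  In the coordinates \<open>A = \<nu> - \<mu>\<close> and \<open>B = \<nu> + \<mu>\<close>, both integral for the two given initial values, the
  ladder operators become the quadratic expressions in two commuting oscillators, one shifting \<open>A\<close>
  and one shifting \<open>B\<close>.  With principal square roots of the single factors the canonical
  commutation relations hold on all of \<open>\<int>\<^sup>2\<close>, so the commutator of two quadratic forms is again a
  quadratic form, and the existence of the representation reduces to an identity of
  \<open>4 \<times> 4\<close> matrices.

  On the stated subspace, where \<open>A, B \<ge> 0\<close>, all coefficients are determined.  Raising and lowering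
  operators are adjoint to each other there, which gives skew-Hermitian matrices.  \<open>J\<^sub>3\<close> and \<open>K\<^sub>3\<close>
  have distinct joint eigenvalues, so an invariant subspace is spanned by basis vectors, and
  \<open>J\<^sub>\<plusminus>\<close>, \<open>R\<^sub>\<plusminus>\<close> connect any two of these with nonzero coefficients.  The functions are linearly
  independent because the powers of \<open>r\<close> and of \<open>exp (\<i> \<phi>)\<close> are and no Ferrers function
  vanishes identically.
\<close>

section \<open>Linear maps on the formal span\<close>

lemma scl_bas: "a \<odot> bas k = Poly_Mapping.single k a"
  by (rule poly_mapping_eqI) (auto simp: bas_def lookup_single when_def)

lemma lookup_bas: "Poly_Mapping.lookup (bas k) i = (if k = i then 1 else 0)"
  by (simp add: bas_def lookup_single when_def)

lemma fvec_expand: "v = (\<Sum>k\<in>Poly_Mapping.keys v. Poly_Mapping.lookup v k \<odot> bas k)"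
  by (rule poly_mapping_eqI) (simp add: lookup_sum scl_bas lookup_single when_def in_keys_iff)

lemma lookup_double: "Poly_Mapping.lookup (2 * v :: fvec) k = 2 * Poly_Mapping.lookup v k"
  by (simp only: mult_2 lookup_add)

lemma fs_linearI:
  assumes "\<And>u v. f (u + v) = f u + f v" "\<And>a v. f (a \<odot> v) = a \<odot> f v"
  shows "Vector_Spaces.linear scl scl f"
  using assms by unfold_locales auto

lemma fs_linear_hom: "Vector_Spaces.linear scl scl f \<Longrightarrow> module_hom scl scl f"
  by (simp add: Vector_Spaces.linear_def)

lemmas fs_linear_add = module_hom.add[OF fs_linear_hom]
lemmas fs_linear_scale = module_hom.scale[OF fs_linear_hom]
lemmas fs_linear_sum = module_hom.sum[OF fs_linear_hom]
lemmas fs_linear_diff = module_hom.diff[OF fs_linear_hom]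

lemma fs_linear_eqI:
  assumes f: "Vector_Spaces.linear scl scl f" and g: "Vector_Spaces.linear scl scl g"
    and eq: "\<And>k. f (bas k) = g (bas k)"
  shows "f v = g v"
proof -
  have "h v = (\<Sum>k\<in>Poly_Mapping.keys v. Poly_Mapping.lookup v k \<odot> h (bas k))"
    if "Vector_Spaces.linear scl scl h" for h :: "fvec \<Rightarrow> fvec"
    using arg_cong[OF fvec_expand[of v], of h]
    by (simp add: fs_linear_sum[OF that] fs_linear_scale[OF that])
  from this[OF f] this[OF g] show ?thesis by (simp add: eq)
qed

lemma lin_ext_superset:
  assumes "finite S" "Poly_Mapping.keys v \<subseteq> S"
  shows "lin_ext f v = (\<Sum>k\<in>S. Poly_Mapping.lookup v k \<odot> f k)"
  unfolding lin_ext_def using assms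
  by (intro sum.mono_neutral_left) (auto simp: in_keys_iff)

lemma linear_lin_ext: "Vector_Spaces.linear scl scl (lin_ext f)"
proof (rule fs_linearI)
  fix u v :: fvec and a :: complex
  let ?S = "Poly_Mapping.keys u \<union> Poly_Mapping.keys v"
  have "Poly_Mapping.keys (u + v) \<subseteq> ?S" by (rule Poly_Mapping.keys_add)
  then show "lin_ext f (u + v) = lin_ext f u + lin_ext f v"
    by (simp add: lin_ext_superset[of ?S] lookup_add fs.scale_left_distrib sum.distrib)
  have "Poly_Mapping.keys (a \<odot> v) \<subseteq> Poly_Mapping.keys v"
    by (auto simp: in_keys_iff)
  then show "lin_ext f (a \<odot> v) = a \<odot> lin_ext f v"
    by (simp add: lin_ext_superset[of "Poly_Mapping.keys v"] fs.scale_sum_right)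
qed

lemma lin_ext_bas [simp]: "lin_ext f (bas k) = f k"
  by (simp add: lin_ext_def bas_def)

lemma fs_linear_scl_self:
    "Vector_Spaces.linear scl scl (\<lambda>v. a \<odot> v)"
  and fs_linear_scl:
    "Vector_Spaces.linear scl scl f \<Longrightarrow> Vector_Spaces.linear scl scl (\<lambda>v. a \<odot> f v)"
  and fs_linear_uminus:
    "Vector_Spaces.linear scl scl f \<Longrightarrow> Vector_Spaces.linear scl scl (\<lambda>v. - f v)"
  and fs_linear_plus:
    "Vector_Spaces.linear scl scl f \<Longrightarrow> Vector_Spaces.linear scl scl g \<Longrightarrow> Vector_Spaces.linear scl scl (\<lambda>v. f v + g v)"
  and fs_linear_minus:
    "Vector_Spaces.linear scl scl f \<Longrightarrow> Vector_Spaces.linear scl scl g \<Longrightarrow> Vector_Spaces.linear scl scl (\<lambda>v. f v - g v)"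
  and fs_linear_compose:
    "Vector_Spaces.linear scl scl f \<Longrightarrow> Vector_Spaces.linear scl scl g \<Longrightarrow> Vector_Spaces.linear scl scl (\<lambda>v. f (g v))"
  and fs_linear_const_0:
    "Vector_Spaces.linear scl scl (\<lambda>v. 0)"
  by (rule fs_linearI; simp add: fs_linear_add fs_linear_scale algebra_simps
      fs.scale_right_distrib fs.scale_right_diff_distrib)+

lemma fs_linear_sum_fun:
  "(\<And>i. i \<in> S \<Longrightarrow> Vector_Spaces.linear scl scl (f i)) \<Longrightarrow>
    Vector_Spaces.linear scl scl (\<lambda>v. \<Sum>i\<in>S. f i v)"
  by (rule fs_linearI) (simp_all add: fs_linear_add fs_linear_scale sum.distrib fs.scale_sum_right)

lemma linear_operators:
  "Vector_Spaces.linear scl scl (ladder_op c L s)"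
  "Vector_Spaces.linear scl scl (J3 \<mu>0)" "Vector_Spaces.linear scl scl (K3 \<nu>0)"
  "Vector_Spaces.linear scl scl (J1 c)" "Vector_Spaces.linear scl scl (J2 c)"
  "Vector_Spaces.linear scl scl (PC1 c s)" "Vector_Spaces.linear scl scl (PC2 c s)"
  "Vector_Spaces.linear scl scl (PC3 c s)"
  unfolding J1_def[abs_def] J2_def[abs_def] PC1_def[abs_def] PC2_def[abs_def] PC3_def[abs_def]
    ladder_op_def J3_def K3_def
  by (intro fs_linear_scl fs_linear_uminus fs_linear_plus fs_linear_minus linear_lin_ext)+

lemma ladder_op_bas: "ladder_op c L s (bas k) = c L s k \<odot> bas (target L s k)"
  by (simp add: ladder_op_def)

section \<open>Coordinates on so(3,2)\<close>

lemma exhaust_5: "(x::5) = 1 \<or> x = 2 \<or> x = 3 \<or> x = 4 \<or> x = 5"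
proof (induct x)
  case (of_int z)
  then have "0 \<le> z" "z < 5" by simp_all
  then have "z = 0 \<or> z = 1 \<or> z = 2 \<or> z = 3 \<or> z = 4" by arith
  then show ?case by auto
qed

lemma forall_5: "(\<forall>i::5. P i) \<longleftrightarrow> P 1 \<and> P 2 \<and> P 3 \<and> P 4 \<and> P 5"
  by (metis exhaust_5)

lemma UNIV_5: "(UNIV::5 set) = {1, 2, 3, 4, 5}"
  using exhaust_5 by auto

lemma sum_5: "sum f (UNIV::5 set) = f 1 + f 2 + f 3 + f 4 + f 5"
  unfolding UNIV_5 by (simp add: ac_simps)

lemma metric_nth: "metric $ a $ b = (if a = b then (if a = 1 \<or> a = 5 then 1 else - 1) else 0)"
  by (simp add: metric_def)

lemma so32_iff: "X \<in> so32 \<longleftrightarrow> (\<forall>a b. X $ b $ a * metric $ b $ b = - (metric $ a $ a * X $ a $ b))"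
proof -
  have "(transpose X ** metric + metric ** X) $ a $ b = X $ b $ a * metric $ b $ b + metric $ a $ a * X $ a $ b"
    for a b
  proof -
    have "(\<Sum>k\<in>UNIV. X $ k $ a * metric $ k $ b) = (\<Sum>k\<in>UNIV. if k = b then X $ b $ a * metric $ b $ b else 0)"
      by (rule sum.cong) (auto simp: metric_nth)
    moreover have "(\<Sum>k\<in>UNIV. metric $ a $ k * X $ k $ b) = (\<Sum>k\<in>UNIV. if k = a then metric $ a $ a * X $ a $ b else 0)"
      by (rule sum.cong) (auto simp: metric_nth)
    ultimately show ?thesis
      by (simp add: matrix_matrix_mult_def transpose_def)
  qed
  then show ?thesis
    by (simp add: so32_def vec_eq_iff eq_neg_iff_add_eq_0)
qed

lemma so32_entries:
  assumes "X \<in> so32"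
  shows "X $ a $ a = 0"
    "X $ 2 $ 1 = X $ 1 $ 2" "X $ 3 $ 1 = X $ 1 $ 3" "X $ 4 $ 1 = X $ 1 $ 4" "X $ 5 $ 1 = - X $ 1 $ 5"
    "X $ 3 $ 2 = - X $ 2 $ 3" "X $ 4 $ 2 = - X $ 2 $ 4" "X $ 5 $ 2 = X $ 2 $ 5"
    "X $ 4 $ 3 = - X $ 3 $ 4" "X $ 5 $ 3 = X $ 3 $ 5" "X $ 5 $ 4 = X $ 4 $ 5"
proof -
  have *: "X $ b $ a * metric $ b $ b = - (metric $ a $ a * X $ a $ b)" for a b
    using assms unfolding so32_iff by blast
  show "X $ a $ a = 0" using *[of a a] by (auto simp: metric_nth split: if_splits)
  show "X $ 2 $ 1 = X $ 1 $ 2" "X $ 3 $ 1 = X $ 1 $ 3" "X $ 4 $ 1 = X $ 1 $ 4" "X $ 5 $ 1 = - X $ 1 $ 5"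
    "X $ 3 $ 2 = - X $ 2 $ 3" "X $ 4 $ 2 = - X $ 2 $ 4" "X $ 5 $ 2 = X $ 2 $ 5"
    "X $ 4 $ 3 = - X $ 3 $ 4" "X $ 5 $ 3 = X $ 3 $ 5" "X $ 5 $ 4 = X $ 4 $ 5"
    using *[of 2 1] *[of 3 1] *[of 4 1] *[of 5 1] *[of 3 2] *[of 4 2] *[of 5 2] *[of 4 3] *[of 5 3] *[of 5 4]
    by (simp_all add: metric_nth)
qed

text \<open>Coefficients with respect to \<open>generators\<close>, in the order of that list. The
  signs combine the metric factor in \<open>rho\<close> with the signs in
  \<open>upperM\<close>.\<close>

definition coords :: "real ^ 5 ^ 5 \<Rightarrow> real list"
  where "coords X = [X $ 3 $ 4, - X $ 2 $ 4, X $ 2 $ 3, - X $ 2 $ 5, - X $ 3 $ 5, - X $ 4 $ 5,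
    X $ 1 $ 2, X $ 1 $ 3, X $ 1 $ 4, - X $ 1 $ 5]"

lemma sum_lessThan_10: "sum f {..<10::nat} = f 0 + f 1 + f 2 + f 3 + f 4 + f 5 + f 6 + f 7 + f 8 + f 9"
  by (simp add: eval_nat_numeral)

text \<open>Both \<open>X $ a $ b * metric $ b $ b\<close> and the array \<open>skewM\<close> are
  antisymmetric in the two indices, so the pairs \<open>(a, b)\<close> and \<open>(b, a)\<close>
  contribute equally and absorb the factor 1/2.\<close>

lemma rho_expand:
  assumes X: "X \<in> so32"
  shows "rho \<nu>0 \<mu>0 c X v =
    (\<Sum>k<10. of_real (coords X ! k) \<odot> (generators \<nu>0 \<mu>0 c ! k) v)"
  by (rule poly_mapping_eqI, unfold rho_def sum_5)
    (simp add: skewM_def upperM_def metric_nth so32_entries[OF X] sum_lessThan_10 coords_def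
      generators_def lookup_add lookup_minus lookup_double algebra_simps)

lemma fs_linear_if:
  "Vector_Spaces.linear scl scl f \<Longrightarrow> Vector_Spaces.linear scl scl g \<Longrightarrow>
    Vector_Spaces.linear scl scl (\<lambda>v. if P then f v else g v)"
  by (cases P) simp_all

lemma linear_skewM: "Vector_Spaces.linear scl scl (skewM \<nu>0 \<mu>0 c a b)"
proof -
  have "Vector_Spaces.linear scl scl (upperM \<nu>0 \<mu>0 c a b)" for a b
    unfolding upperM_def[abs_def]
    by (intro fs_linear_if fs_linear_scl fs_linear_uminus fs_linear_const_0 linear_operators)
  then show ?thesis unfolding skewM_def[abs_def] by (intro fs_linear_minus)
qed

lemma linear_rho: "Vector_Spaces.linear scl scl (rho \<nu>0 \<mu>0 c X)"
  unfolding rho_def[abs_def] by (intro fs_linear_sum_fun fs_linear_scl linear_skewM)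

lemma rho_add: "rho \<nu>0 \<mu>0 c (X + Y) v = rho \<nu>0 \<mu>0 c X v + rho \<nu>0 \<mu>0 c Y v"
  by (simp add: rho_def algebra_simps fs.scale_left_distrib sum.distrib add_divide_distrib)

lemma rho_scale: "rho \<nu>0 \<mu>0 c (x *\<^sub>R X) v = of_real x \<odot> rho \<nu>0 \<mu>0 c X v"
  by (simp add: rho_def fs.scale_sum_right algebra_simps)

lemma so32_bracket:
  assumes "X \<in> so32" "Y \<in> so32"
  shows "X ** Y - Y ** X \<in> so32"
proof -
  \<comment> \<open>Passing to the transposed entry reverses the order of the factors, while the
    signs from \<open>X\<close> and \<open>Y\<close> cancel; hence the commutator changes
    sign.\<close>
  have *: "(X ** Y) $ b $ a * metric $ b $ b = metric $ a $ a * (Y ** X) $ a $ b"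
    if "X \<in> so32" "Y \<in> so32" for X Y :: "real ^ 5 ^ 5" and a b
  proof -
    have "X $ b $ k * Y $ k $ a * metric $ b $ b = metric $ a $ a * (Y $ a $ k * X $ k $ b)" for k
    proof -
      have "X $ b $ k * metric $ b $ b = - (metric $ k $ k * X $ k $ b)"
        and "Y $ k $ a * metric $ k $ k = - (metric $ a $ a * Y $ a $ k)"
        using that unfolding so32_iff by blast+
      then show ?thesis by algebra
    qed
    then show ?thesis
      by (simp add: matrix_matrix_mult_def sum_distrib_left sum_distrib_right)
  qed
  show ?thesis
    unfolding so32_iff by (simp add: *[OF assms] *[OF assms(2,1)] left_diff_distrib right_diff_distrib)
qed

section \<open>Quadratic forms in two oscillators\<close>

text \<open>Creation operators (1, 3) and annihilation operators (2, 4). Raising from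
  \<open>a\<close> and lowering from \<open>a + 1\<close> carry the same root, so their product is
  the integer \<open>a + 1\<close> also when it is negative.\<close>

definition osc :: "4 \<Rightarrow> fvec \<Rightarrow> fvec"
  where "osc i = lin_ext (\<lambda>(a, b).
    if i = 1 then csqrt (of_int (a + 1)) \<odot> bas (a + 1, b)
    else if i = 2 then csqrt (of_int a) \<odot> bas (a - 1, b)
    else if i = 3 then csqrt (of_int (b + 1)) \<odot> bas (a, b + 1)
    else csqrt (of_int b) \<odot> bas (a, b - 1))"

text \<open>The symplectic form given by the commutators of the oscillators.\<close>

definition omega :: "complex ^ 4 ^ 4"
  where "omega = (\<chi> i j. if i = 2 \<and> j = 1 \<or> i = 4 \<and> j = 3 then 1
    else if i = 1 \<and> j = 2 \<or> i = 3 \<and> j = 4 then - 1 else 0)"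

text \<open>For symmetric \<open>S\<close> each mixed product occurs in both orders (Weyl ordering),
  so commutators of such forms produce no additive constants.\<close>

definition quad :: "complex ^ 4 ^ 4 \<Rightarrow> fvec \<Rightarrow> fvec"
  where "quad S v = (1/2) \<odot> (\<Sum>i\<in>UNIV. \<Sum>j\<in>UNIV. S $ i $ j \<odot> osc i (osc j v))"

lemma linear_osc: "Vector_Spaces.linear scl scl (osc i)"
  unfolding osc_def by (rule linear_lin_ext)

lemmas osc_linear_simps =
  fs_linear_add[OF linear_osc] fs_linear_scale[OF linear_osc] fs_linear_sum[OF linear_osc]

lemma linear_osc_osc: "Vector_Spaces.linear scl scl (\<lambda>v. osc i (osc j v))"
  by (rule fs_linear_compose[OF linear_osc linear_osc])

lemma linear_quad: "Vector_Spaces.linear scl scl (quad S)"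
  unfolding quad_def[abs_def]
  by (intro fs_linear_scl fs_linear_sum_fun linear_osc_osc)

lemmas quad_linear_simps =
  fs_linear_add[OF linear_quad] fs_linear_scale[OF linear_quad] fs_linear_sum[OF linear_quad]

lemma distinct_4:
  "(1::4) \<noteq> 2" "(1::4) \<noteq> 3" "(1::4) \<noteq> 4" "(2::4) \<noteq> 3" "(2::4) \<noteq> 4" "(3::4) \<noteq> 4"
  "(2::4) \<noteq> 1" "(3::4) \<noteq> 1" "(4::4) \<noteq> 1" "(3::4) \<noteq> 2" "(4::4) \<noteq> 2" "(4::4) \<noteq> 3"
  by simp_all

lemma csqrt_mult_self: "csqrt z * csqrt z = z" "csqrt z * (csqrt z * w) = z * w"
  using power2_csqrt[of z] by (simp_all add: power2_eq_square mult.assoc[symmetric])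

lemma osc_bas:
  "osc 1 (bas (a, b)) = csqrt (of_int (a + 1)) \<odot> bas (a + 1, b)"
  "osc 2 (bas (a, b)) = csqrt (of_int a) \<odot> bas (a - 1, b)"
  "osc 3 (bas (a, b)) = csqrt (of_int (b + 1)) \<odot> bas (a, b + 1)"
  "osc 4 (bas (a, b)) = csqrt (of_int b) \<odot> bas (a, b - 1)"
  by (simp_all add: osc_def)

text \<open>Canonical commutation relations: the two orders of raising and lowering multiply a basis
  vector by \<open>a\<close> and by \<open>a + 1\<close>; steps in different coordinates
  commute.\<close>

lemma osc_commute: "osc i (osc j v) = osc j (osc i v) + omega $ i $ j \<odot> v"
proof (rule fs_linear_eqI[where f = "\<lambda>v. osc i (osc j v)"
      and g = "\<lambda>v. osc j (osc i v) + omega $ i $ j \<odot> v"])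
  show "Vector_Spaces.linear scl scl (\<lambda>v. osc i (osc j v))"
    and "Vector_Spaces.linear scl scl (\<lambda>v. osc j (osc i v) + omega $ i $ j \<odot> v)"
    by (intro linear_osc_osc fs_linear_plus[OF linear_osc_osc fs_linear_scl_self])+
  show "osc i (osc j (bas k)) = osc j (osc i (bas k)) + omega $ i $ j \<odot> bas k" for k
  proof -
    obtain a b where k: "k = (a, b)" by (cases k)
    have 1: "(c + 1) \<odot> w = c \<odot> w + w" for c w
      by (simp add: fs.scale_left_distrib)
    show ?thesis
      using exhaust_4[of i] exhaust_4[of j] unfolding k
      by (elim disjE; simp add: osc_bas osc_linear_simps omega_def distinct_4 csqrt_mult_self 1 mult.commute)
  qed
qed

text \<open>The commutator with a quadratic form maps oscillators to linear combinations of
  oscillators. Each of the two factors of the form contributes the same sum, by symmetry of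
  \<open>S\<close>, which cancels the 1/2.\<close>

lemma quad_osc:
  assumes S: "transpose S = S"
  shows "quad S (osc k v) = osc k (quad S v) + (\<Sum>i\<in>UNIV. (S ** omega) $ i $ k \<odot> osc i v)"
proof -
  have sym: "S $ i $ j = S $ j $ i" for i j
    using arg_cong[OF S, of "\<lambda>M. M $ i $ j"] by (simp add: transpose_def)
  have 1: "osc i (osc j (osc k v)) = osc k (osc i (osc j v)) + (omega $ i $ k \<odot> osc j v + omega $ j $ k \<odot> osc i v)" for i j
    by (simp add: osc_commute[of j k] osc_commute[of i k] osc_linear_simps)
  have 2: "(\<Sum>i\<in>UNIV. \<Sum>j\<in>UNIV. S $ i $ j \<odot> (omega $ i $ k \<odot> osc j v))
    = (\<Sum>i\<in>UNIV. \<Sum>j\<in>UNIV. S $ i $ j \<odot> (omega $ j $ k \<odot> osc i v))"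
    by (subst sum.swap) (simp add: sym)
  have 3: "(\<Sum>i\<in>UNIV. \<Sum>j\<in>UNIV. S $ i $ j \<odot> (omega $ j $ k \<odot> osc i v))
    = (\<Sum>i\<in>UNIV. (S ** omega) $ i $ k \<odot> osc i v)"
    by (simp add: matrix_matrix_mult_def fs.scale_sum_left)
  have 4: "x + (1/2) \<odot> (w + w) = x + w" for x w
    by (rule poly_mapping_eqI) (simp add: lookup_add lookup_double)
  show ?thesis
    by (simp only: quad_def 1 fs.scale_right_distrib sum.distrib 2 3 osc_linear_simps)
      (simp add: fs.scale_right_distrib 4 fs.scale_left_distrib[symmetric] add.assoc)
qed

text \<open>The commutator with \<open>quad S\<close> is a derivation, so \<open>quad_osc\<close>
  applies to either factor of every product of two oscillators in \<open>quad T\<close>.\<close>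

lemma quad_bracket:
  assumes S: "transpose S = S" and T: "transpose T = T"
  shows "quad S (quad T v) - quad T (quad S v) = quad (S ** omega ** T - T ** omega ** S) v"
proof -
  have sym: "S $ i $ j = S $ j $ i" for i j
    using arg_cong[OF S, of "\<lambda>M. M $ i $ j"] by (simp add: transpose_def)
  have omega: "omega $ j $ i = - omega $ i $ j" for i j
    using exhaust_4[of i] exhaust_4[of j] by (elim disjE) (simp_all add: omega_def)
  let ?P = "S ** omega"
  have "quad S (osc k (osc l v)) - osc k (osc l (quad S v))
    = (\<Sum>i\<in>UNIV. ?P $ i $ k \<odot> osc i (osc l v)) + (\<Sum>i\<in>UNIV. ?P $ i $ l \<odot> osc k (osc i v))" for k l
    by (simp add: quad_osc[OF S] osc_linear_simps)
  then have "quad S (quad T v) - quad T (quad S v) =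
    (1/2) \<odot> (\<Sum>k\<in>UNIV. \<Sum>l\<in>UNIV. T $ k $ l \<odot>
      ((\<Sum>i\<in>UNIV. ?P $ i $ k \<odot> osc i (osc l v)) + (\<Sum>i\<in>UNIV. ?P $ i $ l \<odot> osc k (osc i v))))"
    by (simp add: quad_def[of T] quad_linear_simps fs.scale_right_diff_distrib[symmetric] sum_subtractf[symmetric])
  also have "(\<Sum>k\<in>UNIV. \<Sum>l\<in>UNIV. T $ k $ l \<odot>
      ((\<Sum>i\<in>UNIV. ?P $ i $ k \<odot> osc i (osc l v)) + (\<Sum>i\<in>UNIV. ?P $ i $ l \<odot> osc k (osc i v))))
    = (\<Sum>k\<in>UNIV. \<Sum>l\<in>UNIV. \<Sum>i\<in>UNIV. (T $ k $ l * ?P $ i $ k) \<odot> osc i (osc l v))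
    + (\<Sum>k\<in>UNIV. \<Sum>l\<in>UNIV. \<Sum>i\<in>UNIV. (T $ k $ l * ?P $ i $ l) \<odot> osc k (osc i v))"
    by (simp add: fs.scale_right_distrib fs.scale_sum_right sum.distrib)
  also have "(\<Sum>k\<in>UNIV. \<Sum>l\<in>UNIV. \<Sum>i\<in>UNIV. (T $ k $ l * ?P $ i $ k) \<odot> osc i (osc l v))
    = (\<Sum>i\<in>UNIV. \<Sum>l\<in>UNIV. \<Sum>k\<in>UNIV. (T $ k $ l * ?P $ i $ k) \<odot> osc i (osc l v))"
    by (subst sum.swap, subst (2) sum.swap, subst sum.swap) simp
  also have "\<dots> = (\<Sum>i\<in>UNIV. \<Sum>l\<in>UNIV. (?P ** T) $ i $ l \<odot> osc i (osc l v))"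
    by (simp add: matrix_matrix_mult_def[of ?P] fs.scale_sum_left mult.commute)
  also have "(\<Sum>k\<in>UNIV. \<Sum>l\<in>UNIV. \<Sum>i\<in>UNIV. (T $ k $ l * ?P $ i $ l) \<odot> osc k (osc i v))
    = (\<Sum>k\<in>UNIV. \<Sum>i\<in>UNIV. \<Sum>l\<in>UNIV. (T $ k $ l * ?P $ i $ l) \<odot> osc k (osc i v))"
    by (subst (2) sum.swap) simp
  also have "\<dots> = (\<Sum>k\<in>UNIV. \<Sum>i\<in>UNIV. - (T ** omega ** S) $ k $ i \<odot> osc k (osc i v))"
  proof -
    \<comment> \<open>\<open>S\<close> is symmetric and \<open>omega\<close> antisymmetric, so the
      transpose of \<open>S ** omega\<close> is minus \<open>omega ** S\<close>.\<close>
    have "?P $ i $ l = - (omega ** S) $ l $ i" for i l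
      by (simp add: matrix_matrix_mult_def sum_negf[symmetric] sym[of i] omega[of l] mult.commute)
    then have "(\<Sum>l\<in>UNIV. T $ k $ l * ?P $ i $ l) = - (T ** omega ** S) $ k $ i" for k i
      by (subst matrix_mul_assoc[symmetric], subst matrix_matrix_mult_def[of T]) (simp add: sum_negf)
    then show ?thesis by (simp add: fs.scale_sum_left[symmetric])
  qed
  finally show ?thesis
    by (simp add: quad_def fs.scale_left_diff_distrib sum_subtractf sum_negf)
qed

section \<open>Existence of the representation\<close>

text \<open>Both initial pairs have \<nu>0 = \<mu>0 = \<delta>/2 with \<delta> = 0 or 1, so that A =
  n - m and B = n + m + \<delta> are integers.\<close>

lemma radicand_half:
  "radicand LJ 1 (of_int \<delta> / 2 + of_int n) (of_int \<delta> / 2 + of_int m) = of_int ((n - m) * (n + m + \<delta> + 1))"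
  "radicand LJ (-1) (of_int \<delta> / 2 + of_int n) (of_int \<delta> / 2 + of_int m) = of_int ((n - m + 1) * (n + m + \<delta>))"
  "radicand LK 1 (of_int \<delta> / 2 + of_int n) (of_int \<delta> / 2 + of_int m) = of_int ((n - m + 1) * (n + m + \<delta> + 1))"
  "radicand LK (-1) (of_int \<delta> / 2 + of_int n) (of_int \<delta> / 2 + of_int m) = of_int ((n - m) * (n + m + \<delta>))"
  "radicand LR 1 (of_int \<delta> / 2 + of_int n) (of_int \<delta> / 2 + of_int m) = of_int ((n + m + \<delta> + 1) * (n + m + \<delta> + 2))"
  "radicand LR (-1) (of_int \<delta> / 2 + of_int n) (of_int \<delta> / 2 + of_int m) = of_int ((n + m + \<delta>) * (n + m + \<delta> - 1))"
  "radicand LS 1 (of_int \<delta> / 2 + of_int n) (of_int \<delta> / 2 + of_int m) = of_int ((n - m + 1) * (n - m + 2))"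
  "radicand LS (-1) (of_int \<delta> / 2 + of_int n) (of_int \<delta> / 2 + of_int m) = of_int ((n - m) * (n - m - 1))"
  by (simp_all add: field_simps)

text \<open>The region is the quadrant A, B \<ge> 0. Adding these bounds gives 0 \<le> 2n +
  \<delta>, hence n \<ge> 0 because \<delta> \<le> 1.\<close>

lemma sub_index_half:
  assumes "\<delta> = 0 \<or> \<delta> = 1"
  shows "(n, m) \<in> sub_index (of_int \<delta> / 2) (of_int \<delta> / 2) \<longleftrightarrow> m \<le> n \<and> 0 \<le> n + m + \<delta>"
proof -
  have eq: "of_int \<delta> / 2 + of_int m = - (of_int \<delta> / 2 + of_int n) + real j \<longleftrightarrow> n + m + \<delta> = int j" for j
  proof -
    have "of_int \<delta> / 2 + of_int m = - (of_int \<delta> / 2 + of_int n) + real j \<longleftrightarrow>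
      real_of_int (n + m + \<delta>) = real_of_int (int j)"
      by auto
    then show ?thesis by (simp only: of_int_eq_iff)
  qed
  have "(\<exists>j. n + m + \<delta> = int j) \<longleftrightarrow> 0 \<le> n + m + \<delta>"
    by (metis nonneg_int_cases of_nat_0_le_iff)
  then show ?thesis
    using assms unfolding sub_index_def mem_Collect_eq prod.case eq by auto
qed

text \<open>These are exactly the coefficients that arise from two successive oscillator
  steps.\<close>

fun factored_roots :: "int \<Rightarrow> roots"
  where
    "factored_roots \<delta> LJ s (n, m) = (if s = 1
       then csqrt (of_int (n - m)) * csqrt (of_int (n + m + \<delta> + 1))
       else csqrt (of_int (n - m + 1)) * csqrt (of_int (n + m + \<delta>)))"
  | "factored_roots \<delta> LK s (n, m) = (if s = 1
       then csqrt (of_int (n - m + 1)) * csqrt (of_int (n + m + \<delta> + 1))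
       else csqrt (of_int (n - m)) * csqrt (of_int (n + m + \<delta>)))"
  | "factored_roots \<delta> LR s (n, m) = (if s = 1
       then csqrt (of_int (n + m + \<delta> + 1)) * csqrt (of_int (n + m + \<delta> + 2))
       else csqrt (of_int (n + m + \<delta>)) * csqrt (of_int (n + m + \<delta> - 1)))"
  | "factored_roots \<delta> LS s (n, m) = (if s = 1
       then csqrt (of_int (n - m + 1)) * csqrt (of_int (n - m + 2))
       else csqrt (of_int (n - m)) * csqrt (of_int (n - m - 1)))"

text \<open>The second factor may be negative when the first one vanishes; this happens on the
  boundary, for instance in \<open>(n - m) * (n - m - 1)\<close> at \<open>n = m\<close>.\<close>

lemma csqrt_mult_nonneg:
  assumes "0 \<le> a" "a \<noteq> 0 \<Longrightarrow> 0 \<le> b"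
  shows "csqrt (of_int a) * csqrt (of_int b) = of_real (sqrt (of_int (a * b)))"
proof -
  have "csqrt (of_int c) = of_real (sqrt (of_int c))" if "0 \<le> c" for c
    using of_real_sqrt[of "of_int c"] that by simp
  then show ?thesis using assms by (cases "a = 0") (simp_all add: real_sqrt_mult)
qed

lemma admissible_factored_roots:
  assumes \<delta>: "\<delta> = 0 \<or> \<delta> = 1"
  shows "admissible_roots (of_int \<delta> / 2) (of_int \<delta> / 2) (factored_roots \<delta>)"
  unfolding admissible_roots_def
proof (intro allI ballI conjI impI)
  fix L :: ladder and s n m :: int
  assume s: "s \<in> {1, -1}"
  show "(factored_roots \<delta> L s (n, m))\<^sup>2 =
      of_real (radicand L s (of_int \<delta> / 2 + of_int n) (of_int \<delta> / 2 + of_int m))"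
    using s by (cases L) (auto simp: radicand_half power_mult_distrib simp del: radicand.simps)
  assume "(n, m) \<in> sub_index (of_int \<delta> / 2) (of_int \<delta> / 2)"
  then have "m \<le> n" "0 \<le> n + m + \<delta>"
    by (simp_all add: sub_index_half[OF \<delta>])
  then have roots:
    "csqrt (of_int (n - m)) * csqrt (of_int (n + m + \<delta> + 1)) = of_real (sqrt (of_int ((n - m) * (n + m + \<delta> + 1))))"
    "csqrt (of_int (n - m + 1)) * csqrt (of_int (n + m + \<delta>)) = of_real (sqrt (of_int ((n - m + 1) * (n + m + \<delta>))))"
    "csqrt (of_int (n - m + 1)) * csqrt (of_int (n + m + \<delta> + 1)) = of_real (sqrt (of_int ((n - m + 1) * (n + m + \<delta> + 1))))"
    "csqrt (of_int (n - m)) * csqrt (of_int (n + m + \<delta>)) = of_real (sqrt (of_int ((n - m) * (n + m + \<delta>))))"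
    "csqrt (of_int (n + m + \<delta> + 1)) * csqrt (of_int (n + m + \<delta> + 2)) = of_real (sqrt (of_int ((n + m + \<delta> + 1) * (n + m + \<delta> + 2))))"
    "csqrt (of_int (n + m + \<delta>)) * csqrt (of_int (n + m + \<delta> - 1)) = of_real (sqrt (of_int ((n + m + \<delta>) * (n + m + \<delta> - 1))))"
    "csqrt (of_int (n - m + 1)) * csqrt (of_int (n - m + 2)) = of_real (sqrt (of_int ((n - m + 1) * (n - m + 2))))"
    "csqrt (of_int (n - m)) * csqrt (of_int (n - m - 1)) = of_real (sqrt (of_int ((n - m) * (n - m - 1))))"
    by (intro csqrt_mult_nonneg; linarith)+
  from s have "s = 1 \<or> s = -1 \<and> s \<noteq> 1" by auto
  then show "factored_roots \<delta> L s (n, m) =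
      of_real (sqrt (radicand L s (of_int \<delta> / 2 + of_int n) (of_int \<delta> / 2 + of_int m)))"
    by (cases L; elim disjE conjE)
      (simp_all only: factored_roots.simps radicand_half roots if_True if_False)
qed

text \<open>
  In the coordinates \<open>A = \<nu> - \<mu>\<close>, \<open>B = \<nu> + \<mu>\<close> every ladder operator is a product of two of the
  four oscillators; a single oscillator leaves the image of this embedding, since it changes the
  parity of \<open>A + B\<close>.
\<close>

definition emb :: "int \<Rightarrow> fvec \<Rightarrow> fvec"
  where "emb \<delta> = lin_ext (\<lambda>(n, m). bas (n - m, n + m + \<delta>))"

lemma linear_emb: "Vector_Spaces.linear scl scl (emb \<delta>)"
  unfolding emb_def by (rule linear_lin_ext)

lemmas emb_linear_simps =
  fs_linear_add[OF linear_emb] fs_linear_diff[OF linear_emb] fs_linear_scale[OF linear_emb]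

lemma emb_bas: "emb \<delta> (bas (n, m)) = bas (n - m, n + m + \<delta>)"
  by (simp add: emb_def)

lemma emb_inject:
  assumes "emb \<delta> u = emb \<delta> v"
  shows "u = v"
proof -
  \<comment> \<open>A left inverse: on the image, \<open>a + b - \<delta>\<close> is
    \<open>2 * n\<close> and \<open>b - \<delta> - a\<close> is \<open>2 * m\<close>, so both
    divisions are exact.\<close>
  define proj where "proj = lin_ext (\<lambda>(a, b). bas ((a + b - \<delta>) div 2, (b - \<delta> - a) div 2))"
  have 1: "proj (emb \<delta> (bas k)) = bas k" for k
    by (cases k) (simp add: proj_def emb_bas)
  have lin: "Vector_Spaces.linear scl scl (\<lambda>w. proj (emb \<delta> w))"
    unfolding proj_def by (rule fs_linear_compose[OF linear_lin_ext linear_emb])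
  have "proj (emb \<delta> w) = w" for w
    using fs_linear_eqI[OF lin fs.linear_ident 1] .
  then show ?thesis by (metis assms)
qed

text \<open>Raising \<open>n\<close> raises A and B; raising \<open>m\<close> lowers A and raises B.
  The steps of R change only B, those of S only A, by two.\<close>

lemma emb_ladder:
  "emb \<delta> (ladder_op (factored_roots \<delta>) LJ 1 v) = osc 2 (osc 3 (emb \<delta> v))"
  "emb \<delta> (ladder_op (factored_roots \<delta>) LJ (-1) v) = osc 1 (osc 4 (emb \<delta> v))"
  "emb \<delta> (ladder_op (factored_roots \<delta>) LK 1 v) = osc 1 (osc 3 (emb \<delta> v))"
  "emb \<delta> (ladder_op (factored_roots \<delta>) LK (-1) v) = osc 2 (osc 4 (emb \<delta> v))"
  "emb \<delta> (ladder_op (factored_roots \<delta>) LR 1 v) = osc 3 (osc 3 (emb \<delta> v))"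
  "emb \<delta> (ladder_op (factored_roots \<delta>) LR (-1) v) = osc 4 (osc 4 (emb \<delta> v))"
  "emb \<delta> (ladder_op (factored_roots \<delta>) LS 1 v) = osc 1 (osc 1 (emb \<delta> v))"
  "emb \<delta> (ladder_op (factored_roots \<delta>) LS (-1) v) = osc 2 (osc 2 (emb \<delta> v))"
proof -
  have eqI: "emb \<delta> (ladder_op (factored_roots \<delta>) L s v) = osc i (osc j (emb \<delta> v))"
    if "\<And>k. emb \<delta> (ladder_op (factored_roots \<delta>) L s (bas k)) = osc i (osc j (emb \<delta> (bas k)))" for L s i j
    using that by (rule fs_linear_eqI[rotated 2])
      (rule fs_linear_compose[OF linear_emb linear_operators(1)]
        fs_linear_compose[OF linear_osc_osc linear_emb])+
  show "emb \<delta> (ladder_op (factored_roots \<delta>) LJ 1 v) = osc 2 (osc 3 (emb \<delta> v))"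
    "emb \<delta> (ladder_op (factored_roots \<delta>) LJ (-1) v) = osc 1 (osc 4 (emb \<delta> v))"
    "emb \<delta> (ladder_op (factored_roots \<delta>) LK 1 v) = osc 1 (osc 3 (emb \<delta> v))"
    "emb \<delta> (ladder_op (factored_roots \<delta>) LK (-1) v) = osc 2 (osc 4 (emb \<delta> v))"
    "emb \<delta> (ladder_op (factored_roots \<delta>) LR 1 v) = osc 3 (osc 3 (emb \<delta> v))"
    "emb \<delta> (ladder_op (factored_roots \<delta>) LR (-1) v) = osc 4 (osc 4 (emb \<delta> v))"
    "emb \<delta> (ladder_op (factored_roots \<delta>) LS 1 v) = osc 1 (osc 1 (emb \<delta> v))"
    "emb \<delta> (ladder_op (factored_roots \<delta>) LS (-1) v) = osc 2 (osc 2 (emb \<delta> v))"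
    by (rule eqI; clarify;
      simp add: ladder_op_bas fs_linear_scale[OF linear_emb] emb_bas osc_bas osc_linear_simps algebra_simps)+
qed

text \<open>The number operators \<open>osc 1 (osc 2 _)\<close> and \<open>osc 3 (osc 4 _)\<close>
  have eigenvalues A and B, and \<mu> = (B - A)/2, \<nu> + 1/2 = (A + B + 1)/2.\<close>

lemma emb_diagonal:
  "emb \<delta> (J3 (of_int \<delta> / 2) v) = (1/2) \<odot> (osc 3 (osc 4 (emb \<delta> v)) - osc 1 (osc 2 (emb \<delta> v)))"
  "emb \<delta> (K3 (of_int \<delta> / 2) v) = (1/2) \<odot> (osc 3 (osc 4 (emb \<delta> v)) + osc 1 (osc 2 (emb \<delta> v)) + emb \<delta> v)"
proof -
  note simps = emb_linear_simps osc_linear_simps fs.scale_right_distrib fs.scale_right_diff_distrib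
  have "Vector_Spaces.linear scl scl (\<lambda>v. (1/2) \<odot> (osc 3 (osc 4 (emb \<delta> v)) - osc 1 (osc 2 (emb \<delta> v))))"
    by (rule fs_linearI) (simp_all add: simps mult.commute)
  then show "emb \<delta> (J3 (of_int \<delta> / 2) v) = (1/2) \<odot> (osc 3 (osc 4 (emb \<delta> v)) - osc 1 (osc 2 (emb \<delta> v)))"
    by (rule fs_linear_eqI[OF fs_linear_compose[OF linear_emb linear_operators(2)]])
     (auto intro!: poly_mapping_eqI simp: J3_def emb_linear_simps emb_bas osc_bas osc_linear_simps
      csqrt_mult_self lookup_minus add.assoc add_diff_eq; simp add: field_simps)
  have "Vector_Spaces.linear scl scl
      (\<lambda>v. (1/2) \<odot> (osc 3 (osc 4 (emb \<delta> v)) + osc 1 (osc 2 (emb \<delta> v)) + emb \<delta> v))"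
    by (rule fs_linearI) (simp_all add: simps mult.commute)
  then show "emb \<delta> (K3 (of_int \<delta> / 2) v) = (1/2) \<odot> (osc 3 (osc 4 (emb \<delta> v)) + osc 1 (osc 2 (emb \<delta> v)) + emb \<delta> v)"
    by (rule fs_linear_eqI[OF fs_linear_compose[OF linear_emb linear_operators(3)]])
     (auto intro!: poly_mapping_eqI simp: K3_def emb_linear_simps emb_bas osc_bas osc_linear_simps
      csqrt_mult_self lookup_add add.assoc add_diff_eq; simp add: field_simps)
qed

lemma vector_4:
  "(vector [x, y, z, w] :: 'a::zero ^ 4) $ 1 = x" "(vector [x, y, z, w] :: 'a::zero ^ 4) $ 2 = y"
  "(vector [x, y, z, w] :: 'a::zero ^ 4) $ 3 = z" "(vector [x, y, z, w] :: 'a::zero ^ 4) $ 4 = w"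
  unfolding vector_def by simp_all

text \<open>
  The coefficients of the generators in terms of the products of two oscillators
  (\<open>emb_ladder\<close>, \<open>emb_diagonal\<close>), symmetrised.
\<close>

definition symbol :: "real ^ 5 ^ 5 \<Rightarrow> complex ^ 4 ^ 4"
  where "symbol X = (let x = \<lambda>k. complex_of_real (coords X ! k) in (1/2) *\<^sub>R
    vector [
      vector [\<i> * (x 3 - x 7) - x 4 - x 6, \<i> * (x 9 - x 2), \<i> * x 5 - x 8, \<i> * x 0 - x 1],
      vector [\<i> * (x 9 - x 2), \<i> * (x 3 - x 7) + x 4 + x 6, \<i> * x 0 + x 1, \<i> * x 5 + x 8],
      vector [\<i> * x 5 - x 8, \<i> * x 0 + x 1, x 6 - x 4 - \<i> * (x 3 + x 7), \<i> * (x 9 + x 2)],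
      vector [\<i> * x 0 - x 1, \<i> * x 5 + x 8, \<i> * (x 9 + x 2), x 4 - x 6 - \<i> * (x 3 + x 7)]])"

section \<open>Compatibility of \<open>symbol\<close> with the Lie brackets\<close>

lemma transpose_symbol: "transpose (symbol X) = symbol X"
  by (simp add: vec_eq_iff forall_4 transpose_def symbol_def Let_def vector_4)

lemma mult_omega_nth:
  "(S ** omega ** T) $ i $ j = S $ i $ 2 * T $ 1 $ j - S $ i $ 1 * T $ 2 $ j + S $ i $ 4 * T $ 3 $ j - S $ i $ 3 * T $ 4 $ j"
  by (simp add: matrix_matrix_mult_def sum_4 omega_def distinct_4 algebra_simps)

lemma symbol_nth:
  fixes X
  defines "x \<equiv> \<lambda>k. complex_of_real (coords X ! k)"
  shows
    "symbol X $ 1 $ 1 = (\<i> * (x 3 - x 7) - x 4 - x 6) / 2"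
    "symbol X $ 2 $ 2 = (\<i> * (x 3 - x 7) + x 4 + x 6) / 2"
    "symbol X $ 3 $ 3 = (x 6 - x 4 - \<i> * (x 3 + x 7)) / 2"
    "symbol X $ 4 $ 4 = (x 4 - x 6 - \<i> * (x 3 + x 7)) / 2"
    "symbol X $ 1 $ 2 = \<i> * (x 9 - x 2) / 2" "symbol X $ 2 $ 1 = \<i> * (x 9 - x 2) / 2"
    "symbol X $ 1 $ 3 = (\<i> * x 5 - x 8) / 2" "symbol X $ 3 $ 1 = (\<i> * x 5 - x 8) / 2"
    "symbol X $ 1 $ 4 = (\<i> * x 0 - x 1) / 2" "symbol X $ 4 $ 1 = (\<i> * x 0 - x 1) / 2"
    "symbol X $ 2 $ 3 = (\<i> * x 0 + x 1) / 2" "symbol X $ 3 $ 2 = (\<i> * x 0 + x 1) / 2"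
    "symbol X $ 2 $ 4 = (\<i> * x 5 + x 8) / 2" "symbol X $ 4 $ 2 = (\<i> * x 5 + x 8) / 2"
    "symbol X $ 3 $ 4 = \<i> * (x 9 + x 2) / 2" "symbol X $ 4 $ 3 = \<i> * (x 9 + x 2) / 2"
  by (simp_all add: symbol_def Let_def vector_4 x_def complex_eq_iff)

lemma emb_rho:
  assumes X: "X \<in> so32"
  shows "emb \<delta> (rho (of_int \<delta> / 2) (of_int \<delta> / 2) (factored_roots \<delta>) X v) = quad (symbol X) (emb \<delta> v)"
proof -
  \<comment> \<open>Everything is brought to one order of the factors. The constants from the two
    number operators cancel in \<open>J3\<close> and add up to the 1/2 in \<open>K3\<close>.\<close>
  have comm: "osc 2 (osc 1 w) = osc 1 (osc 2 w) + w" "osc 3 (osc 1 w) = osc 1 (osc 3 w)"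
    "osc 3 (osc 2 w) = osc 2 (osc 3 w)" "osc 4 (osc 1 w) = osc 1 (osc 4 w)"
    "osc 4 (osc 2 w) = osc 2 (osc 4 w)" "osc 4 (osc 3 w) = osc 3 (osc 4 w) + w" for w
    by (simp_all add: osc_commute[of 2 1] osc_commute[of 3 1] osc_commute[of 3 2] osc_commute[of 4 1]
      osc_commute[of 4 2] osc_commute[of 4 3] omega_def distinct_4)
  show ?thesis
    unfolding rho_expand[OF X] sum_lessThan_10
    by (rule poly_mapping_eqI)
      (simp add: generators_def J1_def J2_def PC1_def PC2_def PC3_def emb_linear_simps emb_ladder emb_diagonal
        quad_def sum_4 symbol_nth comm lookup_add lookup_minus lookup_double field_simps)
qed

lemma coords_bracket:
  assumes X: "X \<in> so32" and Y: "Y \<in> so32"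
  defines "x \<equiv> \<lambda>k. coords X ! k" and "y \<equiv> \<lambda>k. coords Y ! k" and "z \<equiv> \<lambda>k. coords (X ** Y - Y ** X) ! k"
  shows
    "z 0 = x 7 * y 8 + x 2 * y 1 + x 4 * y 5 - y 7 * x 8 - y 2 * x 1 - y 4 * x 5"
    "z 1 = y 6 * x 8 + y 2 * x 0 + y 3 * x 5 - x 6 * y 8 - x 2 * y 0 - x 3 * y 5"
    "z 2 = x 6 * y 7 + x 1 * y 0 + x 3 * y 4 - y 6 * x 7 - y 1 * x 0 - y 3 * x 4"
    "z 3 = x 6 * y 9 + x 2 * y 4 + y 1 * x 5 - y 6 * x 9 - y 2 * x 4 - x 1 * y 5"
    "z 4 = x 7 * y 9 + y 2 * x 3 + x 0 * y 5 - y 7 * x 9 - x 2 * y 3 - y 0 * x 5"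
    "z 5 = x 8 * y 9 + x 1 * y 3 + y 0 * x 4 - y 8 * x 9 - y 1 * x 3 - x 0 * y 4"
    "z 6 = y 7 * x 2 + x 8 * y 1 + x 9 * y 3 - x 7 * y 2 - y 8 * x 1 - y 9 * x 3"
    "z 7 = x 6 * y 2 + y 8 * x 0 + x 9 * y 4 - y 6 * x 2 - x 8 * y 0 - y 9 * x 4"
    "z 8 = y 6 * x 1 + x 7 * y 0 + x 9 * y 5 - x 6 * y 1 - y 7 * x 0 - y 9 * x 5"
    "z 9 = x 6 * y 3 + x 7 * y 4 + x 8 * y 5 - y 6 * x 3 - y 7 * x 4 - y 8 * x 5"
  unfolding x_def y_def z_def
  by (simp_all add: coords_def matrix_matrix_mult_def sum_5 so32_entries[OF X] so32_entries[OF Y])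

text \<open>After multiplication by \<open>omega\<close> on the right this says that
  \<open>symbol X ** omega\<close> depends on \<open>X\<close> through a Lie algebra homomorphism
  into sp(4), the spin representation of so(3,2).\<close>

lemma symbol_bracket:
  assumes X: "X \<in> so32" and Y: "Y \<in> so32"
  shows "symbol (X ** Y - Y ** X) = symbol X ** omega ** symbol Y - symbol Y ** omega ** symbol X"
  unfolding vec_eq_iff forall_4 vector_minus_component mult_omega_nth symbol_nth coords_bracket[OF X Y]
  by (intro conjI; rule complex_eqI; simp; simp add: field_simps)

text \<open>The bracket relation is checked after applying the injective map \<open>emb\<close>,
  where it is \<open>quad_bracket\<close>.\<close>

lemma lie_rep_factored_roots:
  "lie_rep so32 (rho (of_int \<delta> / 2) (of_int \<delta> / 2) (factored_roots \<delta>))"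
  unfolding lie_rep_def
proof (intro conjI ballI allI)
  fix X Y :: "real ^ 5 ^ 5" and v
  assume X: "X \<in> so32" and Y: "Y \<in> so32"
  let ?r = "rho (of_int \<delta> / 2) (of_int \<delta> / 2) (factored_roots \<delta>)"
  have "emb \<delta> (?r (X ** Y - Y ** X) v) = emb \<delta> (?r X (?r Y v) - ?r Y (?r X v))"
    by (simp add: emb_rho X Y so32_bracket symbol_bracket fs_linear_diff[OF linear_emb]
        quad_bracket transpose_symbol)
  then show "?r (X ** Y - Y ** X) v = ?r X (?r Y v) - ?r Y (?r X v)"
    by (rule emb_inject)
qed (simp_all add: linear_rho rho_add rho_scale)

section \<open>Admissible roots\<close>

locale ladder_roots =
  fixes \<delta> :: int and c :: roots
  assumes delta: "\<delta> = 0 \<or> \<delta> = 1"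
    and admissible: "admissible_roots (of_int \<delta> / 2) (of_int \<delta> / 2) c"
begin

abbreviation index :: "(int \<times> int) set"
  where "index \<equiv> sub_index (of_int \<delta> / 2) (of_int \<delta> / 2)"

abbreviation rep :: "real ^ 5 ^ 5 \<Rightarrow> fvec \<Rightarrow> fvec"
  where "rep \<equiv> rho (of_int \<delta> / 2) (of_int \<delta> / 2) c"

abbreviation gens :: "(fvec \<Rightarrow> fvec) list"
  where "gens \<equiv> generators (of_int \<delta> / 2) (of_int \<delta> / 2) c"

lemma root:
  assumes "m \<le> n" "0 \<le> n + m + \<delta>"
  shows
    "c LJ 1 (n, m) = of_real (sqrt (of_int ((n - m) * (n + m + \<delta> + 1))))"
    "c LJ (-1) (n, m) = of_real (sqrt (of_int ((n - m + 1) * (n + m + \<delta>))))"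
    "c LK 1 (n, m) = of_real (sqrt (of_int ((n - m + 1) * (n + m + \<delta> + 1))))"
    "c LK (-1) (n, m) = of_real (sqrt (of_int ((n - m) * (n + m + \<delta>))))"
    "c LR 1 (n, m) = of_real (sqrt (of_int ((n + m + \<delta> + 1) * (n + m + \<delta> + 2))))"
    "c LR (-1) (n, m) = of_real (sqrt (of_int ((n + m + \<delta>) * (n + m + \<delta> - 1))))"
    "c LS 1 (n, m) = of_real (sqrt (of_int ((n - m + 1) * (n - m + 2))))"
    "c LS (-1) (n, m) = of_real (sqrt (of_int ((n - m) * (n - m - 1))))"
proof -
  have "(n, m) \<in> index" using assms by (simp add: sub_index_half[OF delta])
  then have "c L s (n, m) = of_real (sqrt (radicand L s (of_int \<delta> / 2 + of_int n) (of_int \<delta> / 2 + of_int m)))"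
    if "s \<in> {1, -1}" for L s
    using admissible that unfolding admissible_roots_def by blast
  then show
    "c LJ 1 (n, m) = of_real (sqrt (of_int ((n - m) * (n + m + \<delta> + 1))))"
    "c LJ (-1) (n, m) = of_real (sqrt (of_int ((n - m + 1) * (n + m + \<delta>))))"
    "c LK 1 (n, m) = of_real (sqrt (of_int ((n - m + 1) * (n + m + \<delta> + 1))))"
    "c LK (-1) (n, m) = of_real (sqrt (of_int ((n - m) * (n + m + \<delta>))))"
    "c LR 1 (n, m) = of_real (sqrt (of_int ((n + m + \<delta> + 1) * (n + m + \<delta> + 2))))"
    "c LR (-1) (n, m) = of_real (sqrt (of_int ((n + m + \<delta>) * (n + m + \<delta> - 1))))"
    "c LS 1 (n, m) = of_real (sqrt (of_int ((n - m + 1) * (n - m + 2))))"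
    "c LS (-1) (n, m) = of_real (sqrt (of_int ((n - m) * (n - m - 1))))"
    by (simp_all only: radicand_half insert_iff simp_thms)
qed

text \<open>A step and its reverse have the same radicand, and inside the region both coefficients
  are its nonnegative root, hence real and equal.\<close>

lemma ladder_adjoint:
  assumes "i \<in> index" "j \<in> index" and s: "s \<in> {1, -1}"
  shows "Poly_Mapping.lookup (ladder_op c L s (bas i)) j =
    cnj (Poly_Mapping.lookup (ladder_op c L (- s) (bas j)) i)"
proof -
  obtain n m n' m' where ij: "i = (n, m)" "j = (n', m')" by (cases i, cases j)
  have "m \<le> n" "0 \<le> n + m + \<delta>" "m' \<le> n'" "0 \<le> n' + m' + \<delta>"
    using assms by (simp_all add: sub_index_half[OF delta] ij)
  note root[OF this(1,2)] root[OF this(3,4)]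
  moreover have "c L s i = cnj (c L (- s) j)" if "target L s i = j"
    using s that calculation unfolding ij
    by (cases L) (auto simp del: of_int_add of_int_diff of_int_mult simp add: algebra_simps)
  moreover have "target L s i = j \<longleftrightarrow> target L (- s) j = i"
    using s unfolding ij by (cases L) auto
  ultimately show ?thesis
    by (simp add: ladder_op_bas lookup_bas)
qed

text \<open>By adjointness of raising and lowering, \<open>J1\<close>, \<open>J2\<close>,
  \<open>J3\<close>, \<open>K3\<close> and the \<open>PC\<close> operators with sign 1 are
  Hermitian, those with sign -1 skew-Hermitian. The factors \<open>\<i>\<close> in
  \<open>generators\<close> make all ten skew-Hermitian, and real combinations stay so.\<close>

lemma skew_hermitian_rep:
  assumes X: "X \<in> so32"
  shows "skew_hermitian_on index (mat_entry (rep X))"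
  unfolding skew_hermitian_on_def mat_entry_def
proof (intro ballI)
  fix i j assume i: "i \<in> index" and j: "j \<in> index"
  have adj: "Poly_Mapping.lookup (ladder_op c L 1 (bas i)) j = cnj (Poly_Mapping.lookup (ladder_op c L (-1) (bas j)) i)"
    "Poly_Mapping.lookup (ladder_op c L (-1) (bas i)) j = cnj (Poly_Mapping.lookup (ladder_op c L 1 (bas j)) i)" for L
    using ladder_adjoint[OF i j, of 1 L] ladder_adjoint[OF i j, of "-1" L] by simp_all
  have diag: "Poly_Mapping.lookup (J3 \<mu>0 (bas i)) j = cnj (Poly_Mapping.lookup (J3 \<mu>0 (bas j)) i)"
    "Poly_Mapping.lookup (K3 \<mu>0 (bas i)) j = cnj (Poly_Mapping.lookup (K3 \<mu>0 (bas j)) i)" for \<mu>0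
    by (auto simp: J3_def K3_def lookup_bas split: prod.split)
  show "Poly_Mapping.lookup (rep X (bas j)) i = - cnj (Poly_Mapping.lookup (rep X (bas i)) j)"
    unfolding rho_expand[OF X] sum_lessThan_10
    by (simp add: generators_def J1_def J2_def PC1_def PC2_def PC3_def lookup_add lookup_minus adj diag
        algebra_simps)
qed

section \<open>The real span of the generators\<close>

text \<open>\<open>(2, 0)\<close> serves as a test index: it lies in the region for both \<delta>,
  and all four raising steps have positive radicands there.\<close>

lemma root_pos:
  "c LJ 1 (2, 0) \<noteq> 0" "c LK 1 (2, 0) \<noteq> 0" "c LR 1 (2, 0) \<noteq> 0" "c LS 1 (2, 0) \<noteq> 0"
  using delta root[of 0 2] by auto

lemma nonzero_mult_eq_0:
  "a * z = 0 \<Longrightarrow> a \<noteq> 0 \<Longrightarrow> Re z = 0 \<and> Im z = 0" for a z :: complex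
  by simp

lemma generators_independent:
  assumes eq: "\<And>v. (\<Sum>k<10. of_real (x k) \<odot> (gens ! k) v) = 0"
  shows "\<forall>k<10. x k = 0"
proof -
  have 0: "Poly_Mapping.lookup (\<Sum>k<10. of_real (x k) \<odot> (gens ! k) (bas j)) i = 0" for i j
    by (simp add: eq)
  note simps = sum_lessThan_10 generators_def J1_def J2_def PC1_def PC2_def PC3_def J3_def K3_def ladder_op_bas
    lookup_add lookup_minus lookup_bas
  have "c LJ 1 (2, 0) * (\<i> * x 0 + x 1) = 0"
    using 0[of "(2, 0)" "(2, 1)"] by (simp add: simps field_simps)
  from nonzero_mult_eq_0[OF this root_pos(1)] have 1: "x 0 = 0" "x 1 = 0" by simp_all
  \<comment> \<open>R and S steps have different targets, so their coefficients vanish separately.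
    The real and imaginary parts of both determine the four coordinates of the first two
    \<open>PC\<close> pairs.\<close>
  have "c LR 1 (2, 0) * ((x 6 - x 4) - \<i> * (x 3 + x 7)) = 0"
    using 0[of "(2, 0)" "(3, 1)"] by (simp add: simps field_simps)
  from nonzero_mult_eq_0[OF this root_pos(3)] have 2: "x 6 - x 4 = 0" "x 3 + x 7 = 0" by simp_all
  have "c LS 1 (2, 0) * (- (x 4 + x 6) + \<i> * (x 3 - x 7)) = 0"
    using 0[of "(2, 0)" "(3, -1)"] by (simp add: simps field_simps)
  from nonzero_mult_eq_0[OF this root_pos(4)] have 3: "x 4 + x 6 = 0" "x 3 - x 7 = 0" by simp_all
  have "c LK 1 (2, 0) * (\<i> * x 5 - x 8) = 0"
    using 0[of "(2, 0)" "(3, 0)"] by (simp add: simps field_simps)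
  from nonzero_mult_eq_0[OF this root_pos(2)] have 4: "x 5 = 0" "x 8 = 0" by simp_all
  \<comment> \<open>Diagonal entries mix \<open>J3\<close> and \<open>K3\<close>; two values of
    \<open>m\<close> at the same \<open>n\<close> separate them.\<close>
  have "x 2 * (\<delta> / 2 + m) + x 9 * (\<delta> / 2 + 2 + 1/2) = 0" for m :: int
  proof -
    have "\<i> * of_real (x 2 * (\<delta> / 2 + m) + x 9 * (\<delta> / 2 + 2 + 1/2)) = 0"
      using 0[of "(2, m)" "(2, m)"] by (simp add: simps field_simps)
    then show ?thesis by (simp only: mult_eq_0_iff of_real_eq_0_iff imaginary_unit.simps complex_i_not_zero simp_thms)
  qed
  note diag = this[of 0] this[of 1]
  then have 5: "x 2 = 0" by (simp add: algebra_simps)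
  then have "x 9 * (of_int \<delta> + 5) = 0" using diag(1) by (simp add: field_simps)
  then have "x 9 = 0" using delta by auto
  then show ?thesis using 1 2 3 4 5
    by (auto simp: eval_nat_numeral less_Suc_eq)
qed

end

section \<open>Bijection between so(3,2) and the real span\<close>

lemma coords_inject:
  assumes X: "X \<in> so32" and Y: "Y \<in> so32" and eq: "coords X = coords Y"
  shows "X = Y"
  using eq by (simp add: vec_eq_iff forall_5 coords_def so32_entries[OF X] so32_entries[OF Y])

lemma coords_surj:
  obtains X where "X \<in> so32" "coords X = map x [0..<10]"
proof
  define e :: "5 \<Rightarrow> 5 \<Rightarrow> real" where "e a b =
    (if a = 1 \<and> b = 2 then x 6 else if a = 1 \<and> b = 3 then x 7 else if a = 1 \<and> b = 4 then x 8
     else if a = 1 \<and> b = 5 then - x 9 else if a = 2 \<and> b = 3 then x 2 else if a = 2 \<and> b = 4 then - x 1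
     else if a = 2 \<and> b = 5 then - x 3 else if a = 3 \<and> b = 4 then x 0 else if a = 3 \<and> b = 5 then - x 4
     else if a = 4 \<and> b = 5 then - x 5 else 0)" for a b
  \<comment> \<open>The subtracted term forces the defining relation of \<open>so32\<close>; as
    \<open>e\<close> vanishes below the diagonal, the entries above it, which \<open>coords\<close>
    reads, are unchanged.\<close>
  define X :: "real ^ 5 ^ 5" where "X = (\<chi> a b. e a b - metric $ a $ a * metric $ b $ b * e b a)"
  have sq: "metric $ a $ a * metric $ a $ a = 1" for a by (simp add: metric_nth)
  have "X $ b $ a * metric $ b $ b = - (metric $ a $ a * X $ a $ b)" for a b
    using sq[of a] sq[of b] unfolding X_def vec_lambda_beta by algebra
  then show "X \<in> so32" unfolding so32_iff by blast
  show "coords X = map x [0..<10]"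
    by (simp add: coords_def X_def e_def metric_nth upt_rec eval_nat_numeral)
qed

context ladder_roots
begin

lemma length_gens: "length gens = 10"
  by (simp add: generators_def)

lemma rep_in_span: "X \<in> so32 \<Longrightarrow> rep X \<in> real_span gens"
  unfolding real_span_def
  by (intro CollectI exI[of _ "\<lambda>k. coords X ! k"] ext) (simp add: rho_expand length_gens)

lemma span_in_rep:
  assumes "T \<in> real_span gens"
  obtains X where "X \<in> so32" "T = rep X"
proof -
  from assms obtain x where T: "T = (\<lambda>v. \<Sum>k<length gens. of_real (x k) \<odot> (gens ! k) v)"
    unfolding real_span_def by blast
  obtain X where X: "X \<in> so32" "coords X = map x [0..<10]" by (rule coords_surj)
  then have "T v = rep X v" for v
    unfolding T rho_expand[OF X(1)] X(2) length_gens by (intro sum.cong) simp_all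
  with X(1) show thesis by (intro that) auto
qed

lemma bij_rep: "bij_betw rep so32 (real_span gens)"
  unfolding bij_betw_def
proof
  show "inj_on rep so32"
  proof (rule inj_onI)
    fix X Y assume X: "X \<in> so32" and Y: "Y \<in> so32" and eq: "rep X = rep Y"
    have "(\<Sum>k<10. of_real (coords X ! k - coords Y ! k) \<odot> (gens ! k) v) = 0" for v
      using fun_cong[OF eq, of v] unfolding rho_expand[OF X] rho_expand[OF Y]
      by (simp add: fs.scale_left_diff_distrib sum_subtractf)
    from generators_independent[OF this] have "coords X ! k = coords Y ! k" if "k < 10" for k
      using that by simp
    then have "coords X = coords Y"
      by (intro nth_equalityI) (simp_all add: coords_def)
    then show "X = Y" by (rule coords_inject[OF X Y])
  qed
  show "rep ` so32 = real_span gens"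
    using rep_in_span span_in_rep by blast
qed

end

section \<open>Irreducibility\<close>

lemma span_bas_iff: "v \<in> fs.span (bas ` I) \<longleftrightarrow> Poly_Mapping.keys v \<subseteq> I"
proof
  have "fs.subspace {v. Poly_Mapping.keys v \<subseteq> I}"
  proof (rule fs.subspaceI)
    fix u v :: fvec and a
    assume "u \<in> {v. Poly_Mapping.keys v \<subseteq> I}" "v \<in> {v. Poly_Mapping.keys v \<subseteq> I}"
    then show "u + v \<in> {v. Poly_Mapping.keys v \<subseteq> I}"
      using Poly_Mapping.keys_add[of u v] by blast
  qed (auto simp: in_keys_iff)
  moreover have "bas ` I \<subseteq> {v. Poly_Mapping.keys v \<subseteq> I}"
    by (auto simp: in_keys_iff lookup_bas split: if_splits)
  ultimately show "v \<in> fs.span (bas ` I) \<Longrightarrow> Poly_Mapping.keys v \<subseteq> I"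
    using fs.span_minimal by blast
  assume "Poly_Mapping.keys v \<subseteq> I"
  then show "v \<in> fs.span (bas ` I)"
    by (subst fvec_expand, intro fs.span_sum fs.span_scale) (auto intro: fs.span_base)
qed

lemma linear_preserves_span:
  assumes f: "Vector_Spaces.linear scl scl f" and I: "\<And>k. k \<in> I \<Longrightarrow> f (bas k) \<in> fs.span (bas ` I)"
    and v: "v \<in> fs.span (bas ` I)"
  shows "f v \<in> fs.span (bas ` I)"
proof -
  have "f v = (\<Sum>k\<in>Poly_Mapping.keys v. Poly_Mapping.lookup v k \<odot> f (bas k))"
    using arg_cong[OF fvec_expand[of v], of f] by (simp add: fs_linear_sum[OF f] fs_linear_scale[OF f])
  also have "\<dots> \<in> fs.span (bas ` I)"
    using v I by (intro fs.span_sum fs.span_scale) (auto simp: span_bas_iff)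
  finally show ?thesis .
qed

lemma lookup_diagonal: "Poly_Mapping.lookup (lin_ext (\<lambda>k. e k \<odot> bas k) v) k = e k * Poly_Mapping.lookup v k"
  unfolding lin_ext_def fs.scale_scale
  unfolding scl_bas lookup_sum lookup_single when_def
  by (simp add: in_keys_iff)

text \<open>
  If \<open>k\<close> and \<open>k'\<close> both occur in \<open>v\<close> and \<open>e k \<noteq> e k'\<close>, then subtracting \<open>e k'\<close> times \<open>v\<close> from the
  image of \<open>v\<close> removes \<open>k'\<close> and keeps \<open>k\<close>.
\<close>

lemma diagonal_invariant:
  assumes U: "fs.subspace U"
    and inv: "\<And>e v. e \<in> E \<Longrightarrow> v \<in> U \<Longrightarrow> lin_ext (\<lambda>k. e k \<odot> bas k) v \<in> U"
    and sep: "\<And>k k'. k \<noteq> k' \<Longrightarrow> \<exists>e\<in>E. e k \<noteq> e k'"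
  shows "v \<in> U \<Longrightarrow> k \<in> Poly_Mapping.keys v \<Longrightarrow> bas k \<in> U"
proof (induction "card (Poly_Mapping.keys v)" arbitrary: v rule: less_induct)
  case less
  show ?case
  proof (cases "Poly_Mapping.keys v = {k}")
    case True
    then have "v = Poly_Mapping.lookup v k \<odot> bas k"
      using fvec_expand[of v] by simp
    then have "bas k = inverse (Poly_Mapping.lookup v k) \<odot> v"
      using less.prems(2) by (metis fs.scale_scale fs.scale_one in_keys_iff left_inverse)
    then show ?thesis using less.prems(1) U by (metis fs.subspace_scale)
  next
    case False
    then obtain k' where k': "k' \<in> Poly_Mapping.keys v" "k' \<noteq> k" using less.prems(2) by blast
    then obtain e where e: "e \<in> E" "e k \<noteq> e k'" using sep by metis
    define w where "w = lin_ext (\<lambda>k. e k \<odot> bas k) v - e k' \<odot> v"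
    have lw: "Poly_Mapping.lookup w i = (e i - e k') * Poly_Mapping.lookup v i" for i
      by (simp add: w_def lookup_minus lookup_diagonal algebra_simps)
    have "w \<in> U"
      unfolding w_def using U less.prems(1) e inv by (intro fs.subspace_diff fs.subspace_scale) auto
    moreover have "k \<in> Poly_Mapping.keys w"
      using e less.prems(2) by (simp add: in_keys_iff lw)
    moreover have "Poly_Mapping.keys w \<subset> Poly_Mapping.keys v"
      using k' by (auto simp: in_keys_iff lw)
    then have "card (Poly_Mapping.keys w) < card (Poly_Mapping.keys v)"
      by (intro psubset_card_mono) auto
    ultimately show ?thesis using less.hyps by blast
  qed
qed

section \<open>The invariant subspace and its irreducibility\<close>

context ladder_roots
begin

text \<open>A step that would leave the quadrant A, B \<ge> 0 has a vanishing factor in its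
  radicand.\<close>

lemma ladder_preserves:
  assumes "k \<in> index" "s \<in> {1, -1}"
  shows "ladder_op c L s (bas k) \<in> fs.span (bas ` index)"
proof -
  obtain n m where k: "k = (n, m)" by (cases k)
  have nm: "m \<le> n" "0 \<le> n + m + \<delta>" using assms(1) by (simp_all add: k sub_index_half[OF delta])
  note root[OF nm]
  then have "c L s k = 0 \<or> target L s k \<in> index"
    using nm assms(2) unfolding k
    by (cases L) (auto simp: sub_index_half[OF delta] simp del: of_int_add of_int_diff of_int_mult)
  then show ?thesis
    by (auto simp: ladder_op_bas intro: fs.span_scale fs.span_base fs.span_zero)
qed

lemma rep_preserves:
  assumes X: "X \<in> so32" and v: "v \<in> fs.span (bas ` index)"
  shows "rep X v \<in> fs.span (bas ` index)"
proof (rule linear_preserves_span[OF linear_rho _ v])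
  fix k assume k: "k \<in> index"
  have "J3 \<mu>0 (bas k) \<in> fs.span (bas ` index)" "K3 \<mu>0 (bas k) \<in> fs.span (bas ` index)" for \<mu>0
    using k by (auto simp: J3_def K3_def intro: fs.span_scale fs.span_base split: prod.split)
  moreover have "ladder_op c L 1 (bas k) \<in> fs.span (bas ` index)"
    "ladder_op c L (-1) (bas k) \<in> fs.span (bas ` index)" for L
    by (rule ladder_preserves[OF k], simp)+
  ultimately show "rep X (bas k) \<in> fs.span (bas ` index)"
    unfolding rho_expand[OF X] sum_lessThan_10
    by (simp add: generators_def J1_def J2_def PC1_def PC2_def PC3_def)
      (intro fs.span_add fs.span_diff fs.span_scale fs.span_neg)
qed

lemma irreducible_rep: "irreducible_subrep so32 rep (sub_space (of_int \<delta> / 2) (of_int \<delta> / 2))"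
  unfolding irreducible_subrep_def sub_space_def
proof (intro conjI allI impI)
  show "invariant_subspace so32 rep (fs.span (bas ` index))"
    unfolding invariant_subspace_def using rep_preserves by auto
  have "(0, 0) \<in> index" using delta by (auto simp: sub_index_half)
  then have "bas (0, 0) \<in> fs.span (bas ` index)" by (intro fs.span_base) auto
  moreover have "bas (0, 0) \<noteq> 0" using lookup_bas[of "(0, 0)" "(0, 0)"] by auto
  ultimately show "fs.span (bas ` index) \<noteq> {0}" by blast
next
  fix U assume "invariant_subspace so32 rep U \<and> U \<subseteq> fs.span (bas ` index)"
  then have U: "fs.subspace U" and inv: "\<And>X v. X \<in> so32 \<Longrightarrow> v \<in> U \<Longrightarrow> rep X v \<in> U"
    and sub: "U \<subseteq> fs.span (bas ` index)"
    unfolding invariant_subspace_def by auto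
  note closed = fs.subspace_add[OF U] fs.subspace_diff[OF U] fs.subspace_scale[OF U]
  have gen: "(gens ! k) v \<in> U" if "k < 10" "v \<in> U" for k v
  proof -
    \<comment> \<open>Each generator is the combination with indicator coefficients, hence of the
      form \<open>rep X\<close>.\<close>
    have "gens ! k = (\<lambda>v. \<Sum>j<length gens. of_real (of_bool (j = k)) \<odot> (gens ! j) v)"
    proof
      fix v
      have "(\<Sum>j<length gens. of_real (of_bool (j = k)) \<odot> (gens ! j) v) = (\<Sum>j<length gens. if j = k then (gens ! j) v else 0)"
        by (rule sum.cong) auto
      then show "(gens ! k) v = (\<Sum>j<length gens. of_real (of_bool (j = k)) \<odot> (gens ! j) v)"
        using that by (simp add: length_gens)
    qed
    then have "gens ! k \<in> real_span gens"
      unfolding real_span_def by (intro CollectI exI[of _ "\<lambda>j. of_bool (j = k)"])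
    then show ?thesis using span_in_rep inv that by metis
  qed
  have gens: "\<i> \<odot> J1 c v \<in> U" "\<i> \<odot> J2 c v \<in> U" "\<i> \<odot> J3 (\<delta> / 2) v \<in> U"
    "\<i> \<odot> PC1 c 1 v \<in> U" "\<i> \<odot> PC2 c 1 v \<in> U" "PC1 c (-1) v \<in> U" "PC2 c (-1) v \<in> U"
    "\<i> \<odot> K3 (\<delta> / 2) v \<in> U" if "v \<in> U" for v
    using gen[OF _ that, of 0] gen[OF _ that, of 1] gen[OF _ that, of 2] gen[OF _ that, of 3]
      gen[OF _ that, of 4] gen[OF _ that, of 6] gen[OF _ that, of 7] gen[OF _ that, of 9]
    by (simp_all add: generators_def)
  have ladder: "ladder_op c LJ 1 v \<in> U" "ladder_op c LJ (-1) v \<in> U"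
    "ladder_op c LR 1 v \<in> U" "ladder_op c LR (-1) v \<in> U" if "v \<in> U" for v
  proof -
    \<comment> \<open>\<open>U\<close> is a complex subspace, so the ladder operators can be
      recovered from the generators of the real form.\<close>
    have "ladder_op c LJ 1 v = (-\<i>) \<odot> \<i> \<odot> J1 c v + \<i> \<odot> J2 c v"
      "ladder_op c LJ (-1) v = (-\<i>) \<odot> \<i> \<odot> J1 c v - \<i> \<odot> J2 c v"
      "ladder_op c LR 1 v = PC1 c (-1) v - (-\<i>) \<odot> \<i> \<odot> PC1 c 1 v - \<i> \<odot> PC2 c 1 v + \<i> \<odot> PC2 c (-1) v"
      "ladder_op c LR (-1) v = \<i> \<odot> PC2 c 1 v + \<i> \<odot> PC2 c (-1) v - (-\<i>) \<odot> \<i> \<odot> PC1 c 1 v - PC1 c (-1) v"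
      by (rule poly_mapping_eqI,
        simp only: J1_def J2_def PC1_def PC2_def lookup_add lookup_minus lookup_scl, simp add: field_simps)+
    then show "ladder_op c LJ 1 v \<in> U" "ladder_op c LJ (-1) v \<in> U"
      "ladder_op c LR 1 v \<in> U" "ladder_op c LR (-1) v \<in> U"
      using gens[OF that] by (simp_all only: closed)
  qed
  have move: "bas (target L s (n, m)) \<in> U"
    if "bas (n, m) \<in> U" "c L s (n, m) \<noteq> 0" "ladder_op c L s (bas (n, m)) \<in> U" for L s n m
  proof -
    have "bas (target L s (n, m)) = inverse (c L s (n, m)) \<odot> ladder_op c L s (bas (n, m))"
      using that by (simp add: ladder_op_bas)
    then show ?thesis using that closed by simp
  qed
  show "U = {0} \<or> U = fs.span (bas ` index)"
  proof (cases "U = {0}")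
    case False
    then obtain v where v: "v \<in> U" "v \<noteq> 0" using fs.subspace_0[OF U] by blast
    then obtain n m where nm: "(n, m) \<in> Poly_Mapping.keys v" by (metis keys_eq_empty equals0I old.prod.exhaust)
    have idx: "m \<le> n" "0 \<le> n + m + \<delta>"
      using v(1) sub nm span_bas_iff[of v index] sub_index_half[OF delta, of n m] by blast+
    \<comment> \<open>Eigenvalues of \<open>J3\<close> and \<open>K3\<close>; the first determines
      \<open>m\<close> and the second \<open>n\<close>.\<close>
    define E :: "(int \<times> int \<Rightarrow> complex) set" where
      "E = {\<lambda>k. of_real (\<delta> / 2 + of_int (snd k)), \<lambda>k. of_real (\<delta> / 2 + of_int (fst k) + 1/2)}"
    have J3_K3: "J3 \<mu>0 = lin_ext (\<lambda>k. of_real (\<mu>0 + of_int (snd k)) \<odot> bas k)"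
      "K3 \<mu>0 = lin_ext (\<lambda>k. of_real (\<mu>0 + of_int (fst k) + 1/2) \<odot> bas k)" for \<mu>0
      unfolding J3_def K3_def by (rule arg_cong[of _ _ lin_ext], auto)+
    have "\<And>v. v \<in> U \<Longrightarrow> J3 (\<delta> / 2) v \<in> U" "\<And>v. v \<in> U \<Longrightarrow> K3 (\<delta> / 2) v \<in> U"
      using closed(3)[OF gens(3), of _ "-\<i>"] closed(3)[OF gens(8), of _ "-\<i>"] by simp_all
    then have "lin_ext (\<lambda>k. e k \<odot> bas k) v \<in> U" if "e \<in> E" "v \<in> U" for e v
      using that unfolding E_def J3_K3 by blast
    then have start: "bas (n, m) \<in> U"
      by (rule diagonal_invariant[OF U, of E]) (use v nm in \<open>auto simp: E_def prod_eq_iff\<close>)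
    \<comment> \<open>The route runs up to \<open>m = n\<close> first: the coefficient
      \<open>(n - m) * (n + m + \<delta> + 1)\<close> under the root vanishes only there.\<close>
    have "m + int j \<le> n \<Longrightarrow> bas (n, m + int j) \<in> U" for j
    proof (induction j)
      case (Suc j)
      then have "bas (n, m + int j) \<in> U" by simp
      moreover have "c LJ 1 (n, m + int j) \<noteq> 0"
        using Suc.prems idx root(1)[of "m + int j" n] by auto
      ultimately have "bas (target LJ 1 (n, m + int j)) \<in> U" using ladder(1) by (intro move) auto
      then show ?case by (simp add: algebra_simps)
    qed (use start in simp)
    from this[of "nat (n - m)"] idx have nn: "bas (n, n) \<in> U" by simp
    \<comment> \<open>Along \<open>m = n\<close> the radicand of the lowering R step is
      \<open>(2 * n + \<delta>) * (2 * n + \<delta> - 1)\<close>, which is positive for n \<ge>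
      1.\<close>
    have down: "bas (int j, int j) \<in> U \<Longrightarrow> bas (0, 0) \<in> U" for j
    proof (induction j)
      case (Suc j)
      have "c LR (-1) (int (Suc j), int (Suc j)) \<noteq> 0"
        using delta root(6)[of "int (Suc j)" "int (Suc j)"] by auto
      then have "bas (target LR (-1) (int (Suc j), int (Suc j))) \<in> U"
        using ladder(4) Suc.prems by (intro move) auto
      then show ?case using Suc.IH by simp
    qed simp
    have "0 \<le> n" using idx delta by linarith
    with nn down[of "nat n"] have 0: "bas (0, 0) \<in> U" by simp
    have up: "bas (int j, int j) \<in> U" for j
    proof (induction j)
      case (Suc j)
      have "c LR 1 (int j, int j) \<noteq> 0"
        using delta root(5)[of "int j" "int j"] by auto
      then have "bas (target LR 1 (int j, int j)) \<in> U"
        using ladder(3) Suc.IH by (intro move) auto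
      then show ?case by (simp add: add.commute)
    qed (use 0 in simp)
    \<comment> \<open>From \<open>(n, n)\<close> the lowering J steps reach the whole row; their
      radicand vanishes first at the bottom, \<open>n + m + \<delta> = 0\<close>.\<close>
    have all: "0 \<le> n + (n - int j) + \<delta> \<Longrightarrow> bas (n, n - int j) \<in> U" if "0 \<le> n" for n j
    proof (induction j)
      case 0
      then show ?case using up[of "nat n"] that by simp
    next
      case (Suc j)
      then have "bas (n, n - int j) \<in> U" by simp
      moreover have "c LJ (-1) (n, n - int j) \<noteq> 0"
        using Suc.prems root(2)[of "n - int j" n] by auto
      ultimately have "bas (target LJ (-1) (n, n - int j)) \<in> U" using ladder(2) by (intro move) auto
      then show ?case by (simp add: algebra_simps)
    qed
    have "bas k \<in> U" if "k \<in> index" for k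
    proof -
      obtain n m where k: "k = (n, m)" by (cases k)
      then have "m \<le> n" "0 \<le> n + m + \<delta>" using that by (simp_all add: sub_index_half[OF delta])
      moreover from this have "0 \<le> n" using delta by linarith
      ultimately show ?thesis using all[of n "nat (n - m)"] k by simp
    qed
    then have "fs.span (bas ` index) \<subseteq> U" using U by (intro fs.span_minimal) auto
    then show ?thesis using sub by blast
  qed simp
qed

end

section \<open>Linear independence of the functions\<close>

text \<open>Multiplication by a high power of \<open>w\<close> turns the Laurent polynomial into a
  polynomial with infinitely many zeros.\<close>

lemma powi_independent:
  fixes d :: "int \<Rightarrow> complex"
  assumes F: "finite F" and W: "infinite W" "0 \<notin> W"
    and zero: "\<And>w. w \<in> W \<Longrightarrow> (\<Sum>m\<in>F. d m * w powi m) = 0"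
  shows "\<forall>m\<in>F. d m = 0"
proof -
  obtain M where M: "\<And>m. m \<in> F \<Longrightarrow> - int M \<le> m"
  proof
    show "- int (nat (\<Sum>m\<in>F. \<bar>m\<bar>)) \<le> m" if "m \<in> F" for m
      using member_le_sum[OF that, of abs] F by (simp add: sum_nonneg)
  qed
  define p where "p = (\<Sum>m\<in>F. monom (d m) (nat (m + int M)))"
  have "poly p w = 0" if "w \<in> W" for w
  proof -
    have "w \<noteq> 0" using W that by blast
    have "poly p w = (\<Sum>m\<in>F. w ^ M * (d m * w powi m))"
      unfolding p_def poly_sum poly_monom
    proof (rule sum.cong)
      fix m assume "m \<in> F"
      then have "w ^ nat (m + int M) = w powi (m + int M)"
        using M[of m] by (simp add: power_int_def)
      then show "d m * w ^ nat (m + int M) = w ^ M * (d m * w powi m)"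
        using \<open>w \<noteq> 0\<close> by (simp add: power_int_add)
    qed simp
    also have "\<dots> = 0" by (simp add: zero[OF that] flip: sum_distrib_left)
    finally show ?thesis .
  qed
  then have "W \<subseteq> {w. poly p w = 0}" by blast
  then have "p = 0" using W poly_roots_finite[of p] finite_subset by blast
  have "d m = 0" if "m \<in> F" for m
  proof -
    have "0 = coeff p (nat (m + int M))" using \<open>p = 0\<close> by simp
    also have "\<dots> = (\<Sum>k\<in>F. if k = m then d k else 0)"
      unfolding p_def coeff_sum coeff_monom
    proof (rule sum.cong)
      fix k assume "k \<in> F"
      then have "nat (k + int M) = nat (m + int M) \<longleftrightarrow> k = m" using M[of k] M[OF that] by auto
      then show "(if nat (k + int M) = nat (m + int M) then d k else 0) = (if k = m then d k else 0)" by simp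
    qed simp
    also have "\<dots> = d m" using F that by simp
    finally show ?thesis by simp
  qed
  then show ?thesis by blast
qed

section \<open>The hypergeometric series of the Ferrers functions\<close>

lemma ferrersP_coeff_recurrence:
  fixes \<nu> \<mu> :: real
  defines "a \<equiv> \<lambda>k. pochhammer (\<nu> + 1) k * pochhammer (- \<nu>) k * rGamma (1 - \<mu> + real k) / fact k"
  shows "(1 - \<mu> + real k) * (real k + 1) * a (Suc k) = (\<nu> + 1 + real k) * (real k - \<nu>) * a k"
proof -
  define R where "R = rGamma (1 - \<mu> + real (Suc k))"
  \<comment> \<open>The functional equation of the reciprocal Gamma function holds at its zeros too,
    so the recurrence is kept free of division by \<open>1 - \<mu> + real k\<close>.\<close>
  have "rGamma (1 - \<mu> + real k) = (1 - \<mu> + real k) * R"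
    using rGamma_plus1[of "1 - \<mu> + real k"] by (simp add: R_def algebra_simps)
  then have 1: "a k = pochhammer (\<nu> + 1) k * pochhammer (- \<nu>) k * ((1 - \<mu> + real k) * R) / fact k"
    by (simp only: a_def)
  have 2: "a (Suc k) = pochhammer (\<nu> + 1) k * (\<nu> + 1 + real k) * (pochhammer (- \<nu>) k * (real k - \<nu>)) * R
    / ((real k + 1) * fact k)"
    unfolding a_def pochhammer_Suc R_def by (simp add: add.commute)
  have 3: "x * y * (p * u * (q * w) * R / (y * f)) = u * w * (p * q * (x * R) / f)"
    if "y \<noteq> 0" "f \<noteq> 0" for x y p q u w f :: real
    using that by simp
  show ?thesis unfolding 1 2 by (rule 3) auto
qed

text \<open>Ratio test: consecutive coefficients eventually grow by a factor of at most 3/2, which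
  the bound 1/2 on \<open>z\<close> turns into 3/4.\<close>

lemma ferrersP_coeff_summable:
  fixes \<nu> \<mu> z :: real
  assumes "norm z < 1/2"
  shows "summable (\<lambda>k. pochhammer (\<nu> + 1) k * pochhammer (- \<nu>) k * rGamma (1 - \<mu> + real k) / fact k * z ^ k)"
proof -
  define a where "a k = pochhammer (\<nu> + 1) k * pochhammer (- \<nu>) k * rGamma (1 - \<mu> + real k) / fact k" for k
  \<comment> \<open>Chosen so that both numerator factors of the recurrence are at most 6/5 times
    \<open>real k - \<bar>\<mu>\<bar>\<close>; the square of 6/5 is below 3/2.\<close>
  obtain N where N: "real N \<ge> 5 * \<bar>\<nu>\<bar> + 6 * \<bar>\<mu>\<bar> + 5" using real_arch_simple by blast
  have "summable (\<lambda>k. a k * z ^ k)"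
  proof (rule summable_ratio_test[of "3/4" N])
    fix k assume "k \<ge> N"
    then have "5 * \<bar>\<nu>\<bar> + 6 * \<bar>\<mu>\<bar> + 5 \<le> real k" using N by linarith
    then have le: "\<bar>\<nu>\<bar> + 1 + real k \<le> 6/5 * (real k - \<bar>\<mu>\<bar>)" and k: "0 < 1 - \<mu> + real k" "0 \<le> real k - \<bar>\<mu>\<bar>"
      by (simp_all add: field_simps abs_if split: if_splits)
    have "\<bar>\<nu> + 1 + real k\<bar> * \<bar>real k - \<nu>\<bar> \<le> (6/5 * (real k - \<bar>\<mu>\<bar>)) * (6/5 * (real k - \<bar>\<mu>\<bar>))"
      using le k by (intro mult_mono) linarith+
    also have "\<dots> \<le> 3/2 * ((real k - \<bar>\<mu>\<bar>) * (real k - \<bar>\<mu>\<bar>))"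
      using zero_le_square[of "real k - \<bar>\<mu>\<bar>"] by (simp add: field_simps)
    also have "\<dots> \<le> 3/2 * ((1 - \<mu> + real k) * (real k + 1))"
      using k by (intro mult_left_mono mult_mono) linarith+
    finally have bound: "\<bar>\<nu> + 1 + real k\<bar> * \<bar>real k - \<nu>\<bar> \<le> 3/2 * ((1 - \<mu> + real k) * (real k + 1))" .
    let ?q = "(1 - \<mu> + real k) * (real k + 1)"
    have q: "0 < ?q" using k by simp
    have "?q * \<bar>a (Suc k)\<bar> = \<bar>\<nu> + 1 + real k\<bar> * \<bar>real k - \<nu>\<bar> * \<bar>a k\<bar>"
      using arg_cong[OF ferrersP_coeff_recurrence[of \<mu> k \<nu>], of abs] k
      by (simp add: a_def abs_mult)
    also have "\<dots> \<le> 3/2 * ?q * \<bar>a k\<bar>"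
      by (intro mult_right_mono bound) simp
    finally have "?q * \<bar>a (Suc k)\<bar> \<le> ?q * (3/2 * \<bar>a k\<bar>)" by (simp add: mult_ac)
    then have "\<bar>a (Suc k)\<bar> \<le> 3/2 * \<bar>a k\<bar>" using q by (simp only: mult_le_cancel_left_pos)
    then have "\<bar>a (Suc k)\<bar> * \<bar>z\<bar> \<le> (3/2 * \<bar>a k\<bar>) * (1/2)"
      using assms by (intro mult_mono) auto
    then have "\<bar>a (Suc k)\<bar> * \<bar>z\<bar> * \<bar>z\<bar> ^ k \<le> (3/4 * \<bar>a k\<bar>) * \<bar>z\<bar> ^ k"
      by (intro mult_right_mono) auto
    then show "norm (a (Suc k) * z ^ Suc k) \<le> 3/4 * norm (a k * z ^ k)"
      by (simp add: abs_mult power_abs mult_ac)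
  qed simp
  then show ?thesis by (simp add: a_def)
qed

text \<open>A convergent power series with a nonzero coefficient cannot vanish on an interval to the
  right of 0, and the prefactor of the series is positive.\<close>

lemma ferrersP_nonzero:
  fixes \<nu> \<mu> :: real
  assumes "pochhammer (\<nu> + 1) k \<noteq> 0" "pochhammer (- \<nu>) k \<noteq> 0" "rGamma (1 - \<mu> + real k) \<noteq> 0"
  obtains \<theta> where "0 < \<theta>" "\<theta> < pi" "ferrersP \<nu> \<mu> (cos \<theta>) \<noteq> 0"
proof -
  define a where "a k = pochhammer (\<nu> + 1) k * pochhammer (- \<nu>) k * rGamma (1 - \<mu> + real k) / fact k" for k
  define f where "f z = suminf (\<lambda>k. a k * z ^ k)" for z
  have sums: "(\<lambda>k. a k * z ^ k) sums f z" if "norm z < 1/2" for z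
    using ferrersP_coeff_summable[OF that, of \<nu> \<mu>] unfolding f_def a_def by (rule summable_sums)
  have "a k \<noteq> 0" using assms by (simp add: a_def)
  have "\<exists>z. 0 < z \<and> z < 1/2 \<and> f z \<noteq> 0"
  proof (rule ccontr)
    assume "\<not> ?thesis"
    then have z0: "f z = 0" if "0 < z" "z < 1/2" for z using that by blast
    \<comment> \<open>Dividing by \<open>z ^ j\<close> at the first nonzero coefficient leaves a
      series with constant term \<open>a j\<close>, its limit at 0.\<close>
    define j where "j = (LEAST j. a j \<noteq> 0)"
    have aj: "a j \<noteq> 0" unfolding j_def by (rule LeastI) fact
    have below: "a i = 0" if "i < j" for i using that unfolding j_def by (auto dest: not_less_Least)
    have "(\<lambda>i. a (i + j) * z ^ i) sums (f z / z ^ j)" if "z \<noteq> 0" "norm z < 1/2" for z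
    proof -
      have "(\<lambda>i. a (i + j) * z ^ (i + j)) sums f z"
        using sums_iff_shift[of "\<lambda>k. a k * z ^ k" j "f z"] sums[OF that(2)] by (simp add: below)
      from sums_divide[OF this, of "z ^ j"] show ?thesis
        using that(1) by (simp add: power_add)
    qed
    then have "((\<lambda>z. f z / z ^ j) \<longlongrightarrow> a j) (at 0)"
      using powser_limit_0_strong[of "1/2" "\<lambda>i. a (i + j)" "\<lambda>z. f z / z ^ j"] by simp
    then have lim: "((\<lambda>z. f z / z ^ j) \<longlongrightarrow> a j) (at_right 0)"
      by (rule filterlim_mono) (simp_all add: at_le)
    have "\<forall>\<^sub>F z in at_right 0. f z / z ^ j = 0"
    proof -
      have "\<forall>\<^sub>F z in at_right 0. z \<in> {0<..<1/2 :: real}"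
        by (rule eventually_at_right_real) simp
      then show ?thesis by (rule eventually_mono) (simp add: z0)
    qed
    from tendsto_unique[OF trivial_limit_at_right_real lim tendsto_eventually[OF this]]
    have "a j = 0" .
    then show False using aj by simp
  qed
  then obtain z where z: "0 < z" "z < 1/2" "f z \<noteq> 0" by blast
  \<comment> \<open>Inverts the substitution \<open>z = (1 - x) / 2\<close> with
    \<open>x = cos \<theta>\<close>.\<close>
  let ?x = "1 - 2 * z"
  have x: "cos (arccos ?x) = ?x" using z by (intro cos_arccos) auto
  have "0 < arccos ?x" "arccos ?x < pi" using arccos_lt_bounded[of ?x] z by auto
  moreover have "ferrersP \<nu> \<mu> (cos (arccos ?x)) = ((1 + ?x) / (1 - ?x)) powr (\<mu> / 2) * f z"
    unfolding x ferrersP_def f_def a_def by (simp add: field_simps)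
  moreover have "((1 + ?x) / (1 - ?x)) powr (\<mu> / 2) \<noteq> 0" using z by simp
  ultimately show thesis using z that by (metis mult_eq_0_iff)
qed

section \<open>Separation of variables\<close>

lemma realise_superset:
  assumes "finite N" "finite M" "Poly_Mapping.keys v \<subseteq> N \<times> M"
  shows "realise \<nu>0 \<mu>0 v r \<theta> \<phi> = (\<Sum>m\<in>M. \<Sum>n\<in>N.
    Poly_Mapping.lookup v (n, m) * Shat (\<nu>0 + of_int n) (\<mu>0 + of_int m) r \<theta> \<phi>)"
proof -
  have "realise \<nu>0 \<mu>0 v r \<theta> \<phi> = (\<Sum>(n, m)\<in>N \<times> M.
    Poly_Mapping.lookup v (n, m) * Shat (\<nu>0 + of_int n) (\<mu>0 + of_int m) r \<theta> \<phi>)"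
    unfolding realise_def using assms by (intro sum.mono_neutral_left) (auto simp: in_keys_iff)
  then show ?thesis by (simp add: sum.cartesian_product[symmetric] sum.swap[of _ N])
qed

text \<open>The last factor is common to all indices and nonzero; the rest is a function of \<theta>
  times integer powers in \<open>r\<close> and in the phase.\<close>

lemma Shat_separated:
  assumes "0 < r"
  shows "Shat (\<nu>0 + of_int n) (\<mu>0 + of_int m) r \<theta> \<phi> =
    of_real (sqrt (Gamma (\<nu>0 + of_int n - (\<mu>0 + of_int m) + 1) / Gamma (\<nu>0 + of_int n + (\<mu>0 + of_int m) + 1))
      * ferrersP (\<nu>0 + of_int n) (\<mu>0 + of_int m) (cos \<theta>))
    * of_real r powi n * exp (\<i> * of_real \<phi>) powi m * (of_real (r powr \<nu>0) * exp (\<i> * of_real (\<mu>0 * \<phi>)))"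
proof -
  have "r powr (\<nu>0 + of_int n) = r powr \<nu>0 * r powi n"
    using assms by (simp add: powr_add powr_real_of_int')
  moreover have "exp (\<i> * of_real ((\<mu>0 + of_int m) * \<phi>)) = exp (\<i> * of_real (\<mu>0 * \<phi>)) * exp (\<i> * of_real \<phi>) powi m"
    by (simp add: exp_power_int algebra_simps flip: exp_add)
  ultimately show ?thesis
    unfolding Shat_def by (simp add: of_real_power_int)
qed

text \<open>\<open>powi_independent\<close> is applied to the phase on the unit circle and then to
  \<open>r\<close>. Every coefficient is thereby isolated as a function of \<theta>, and evaluated
  where its Ferrers function is nonzero.\<close>

lemma realise_inject:
  assumes \<delta>: "\<delta> = 0 \<or> \<delta> = 1"
    and v: "Poly_Mapping.keys v \<subseteq> sub_index (of_int \<delta> / 2) (of_int \<delta> / 2)"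
    and zero: "\<And>r \<theta> \<phi>. 0 < r \<Longrightarrow> 0 < \<theta> \<Longrightarrow> \<theta> < pi \<Longrightarrow> realise (of_int \<delta> / 2) (of_int \<delta> / 2) v r \<theta> \<phi> = 0"
  shows "v = 0"
proof -
  let ?h = "of_int \<delta> / 2 :: real"
  let ?N = "fst ` Poly_Mapping.keys v" and ?M = "snd ` Poly_Mapping.keys v"
  have fin: "finite ?N" "finite ?M" by auto
  have sup: "Poly_Mapping.keys v \<subseteq> ?N \<times> ?M" by force
  define t where "t n m \<theta> = of_real (sqrt (Gamma (?h + of_int n - (?h + of_int m) + 1) / Gamma (?h + of_int n + (?h + of_int m) + 1))
      * ferrersP (?h + of_int n) (?h + of_int m) (cos \<theta>)) * Poly_Mapping.lookup v (n, m)" for n m \<theta>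
  have t0: "t n m \<theta> = 0" if "n \<in> ?N" "m \<in> ?M" "0 < \<theta>" "\<theta> < pi" for n m \<theta>
  proof -
    have "(\<Sum>n\<in>?N. t n m \<theta> * of_real r powi n) = 0" if "0 < r" for r :: real
    proof -
      have "(\<Sum>m\<in>?M. (\<Sum>n\<in>?N. t n m \<theta> * of_real r powi n) * w powi m) = 0" if "w \<in> sphere 0 1" for w :: complex
      proof -
        from that have "exp (\<i> * of_real (Arg2pi w)) = w" by (simp flip: complex_norm_eq_1_exp)
        then obtain \<phi> where w: "w = exp (\<i> * of_real \<phi>)" by metis
        have "0 = realise ?h ?h v r \<theta> \<phi>"
          using zero \<open>0 < r\<close> \<open>0 < \<theta>\<close> \<open>\<theta> < pi\<close> by simp
        also have "\<dots> = (\<Sum>m\<in>?M. \<Sum>n\<in>?N. t n m \<theta> * of_real r powi n * w powi m) *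
            (of_real (r powr ?h) * exp (\<i> * of_real (?h * \<phi>)))"
          unfolding realise_superset[OF fin sup] sum_distrib_right
          by (intro sum.cong refl) (simp only: Shat_separated[OF \<open>0 < r\<close>] t_def w mult_ac)
        finally have "(\<Sum>m\<in>?M. \<Sum>n\<in>?N. t n m \<theta> * of_real r powi n * w powi m) = 0"
          using \<open>0 < r\<close> by simp
        then show ?thesis by (simp only: sum_distrib_right)
      qed
      note * = this
      \<comment> \<open>A finite connected set has at most one point, but the unit circle contains 1
        and -1.\<close>
      have "connected (sphere (0::complex) 1)" by (rule connected_sphere) (simp add: DIM_complex)
      moreover have "1 \<in> sphere (0::complex) 1" "- 1 \<in> sphere (0::complex) 1" by simp_all
      ultimately have "infinite (sphere (0::complex) 1)"
        by (metis connected_finite_iff_sing empty_iff one_neq_neg_one singletonD)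
      from powi_independent[OF fin(2) this _ *]
      have "\<forall>m\<in>?M. (\<Sum>n\<in>?N. t n m \<theta> * of_real r powi n) = 0" by simp
      then show ?thesis using \<open>m \<in> ?M\<close> by blast
    qed
    note * = this
    have "infinite (complex_of_real ` {0<..})"
      using infinite_Ioi[of "0::real"] finite_imageD[of complex_of_real] by (auto simp: inj_on_def)
    then have "\<forall>n\<in>?N. t n m \<theta> = 0"
      by (rule powi_independent[OF fin(1)]) (use * in auto)
    then show ?thesis using \<open>n \<in> ?N\<close> by blast
  qed
  have "Poly_Mapping.lookup v k = 0" for k
  proof (rule ccontr)
    assume nz: "Poly_Mapping.lookup v k \<noteq> 0"
    obtain n m where k: "k = (n, m)" by (cases k)
    have mem: "(n, m) \<in> Poly_Mapping.keys v" using nz k by (simp add: in_keys_iff)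
    then have nm: "m \<le> n" "0 \<le> n + m + \<delta>" using v by (auto simp: sub_index_half[OF \<delta>])
    then have "0 \<le> n" using \<delta> by linarith
    \<comment> \<open>For \<open>\<delta> = 0\<close> the series starts at \<open>k = max \<mu> 0\<close> because of the poles of \<open>Gamma\<close>, and ends at \<open>k = \<nu>\<close>.\<close>
    define j where "j = (if \<delta> = 0 then nat m else 0)"
    have "pochhammer (?h + of_int n + 1) j \<noteq> 0"
      using \<delta> \<open>0 \<le> n\<close> by (intro less_imp_neq[symmetric] pochhammer_pos) auto
    moreover have "pochhammer (- (?h + of_int n)) j \<noteq> 0"
    proof -
      have "- (?h + of_int n) \<noteq> - of_nat i" if "i < j" for i
        using nm that \<delta> by (auto simp: j_def split: if_splits)
      then show ?thesis by (auto simp: pochhammer_eq_0_iff)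
    qed
    moreover have "rGamma (1 - (?h + of_int m) + real j) \<noteq> 0"
    proof -
      have "1 - (?h + of_int m) + real j \<notin> \<int>\<^sub>\<le>\<^sub>0"
      proof
        assume "1 - (?h + of_int m) + real j \<in> \<int>\<^sub>\<le>\<^sub>0"
        then obtain i where i: "1 - (?h + of_int m) + real j = - of_nat i" by (elim nonpos_Ints_cases')
        \<comment> \<open>For \<delta> = 1 parity is violated; for \<delta> = 0 the choice of
          \<open>j\<close> makes the left side positive.\<close>
        then have "of_int (2 * (1 - m + int j + int i)) = (of_int \<delta> :: real)" by (simp add: field_simps)
        then have "2 * (1 - m + int j + int i) = \<delta>" by (simp only: of_int_eq_iff)
        then show False using \<delta> unfolding j_def by (cases "\<delta> = 0") (simp_all, presburger+)
      qed
      then show ?thesis by (simp add: rGamma_eq_zero_iff)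
    qed
    ultimately obtain \<theta> where \<theta>: "0 < \<theta>" "\<theta> < pi" "ferrersP (?h + of_int n) (?h + of_int m) (cos \<theta>) \<noteq> 0"
      by (rule ferrersP_nonzero)
    \<comment> \<open>The normalising factor is nonzero inside the region, so only the coefficient
      of \<open>v\<close> could make \<open>t\<close> vanish.\<close>
    have "0 < Gamma (?h + of_int n - (?h + of_int m) + 1)"
      using nm by (intro Gamma_real_pos) simp
    moreover have "0 < Gamma (?h + of_int n + (?h + of_int m) + 1)"
    proof (intro Gamma_real_pos)
      have "?h + of_int n + (?h + of_int m) + 1 = of_int (n + m + \<delta> + 1)" by simp
      also have "\<dots> > (0::real)" using nm by (simp only: of_int_0_less_iff)
      finally show "0 < ?h + of_int n + (?h + of_int m) + 1" .
    qed
    moreover have "n \<in> ?N" "m \<in> ?M" using mem by force+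
    ultimately show False
      using t0[of n m \<theta>] \<theta> nz k by (auto simp: t_def)
  qed
  then show ?thesis by (intro poly_mapping_eqI) simp
qed

text \<open>The first part keeps the second from being vacuous; the third identifies formal vectors
  of the subspace with actual functions.\<close>

theorem theorem9p7:
  fixes \<nu>0 \<mu>0 :: real
  assumes "(\<nu>0, \<mu>0) = (0, 0) \<or> (\<nu>0, \<mu>0) = (1/2, 1/2)"
  shows
    "(\<exists>c. admissible_roots \<nu>0 \<mu>0 c \<and> lie_rep so32 (rho \<nu>0 \<mu>0 c)) \<and>
     (\<forall>c. admissible_roots \<nu>0 \<mu>0 c \<and> lie_rep so32 (rho \<nu>0 \<mu>0 c) \<longrightarrow>
        bij_betw (rho \<nu>0 \<mu>0 c) so32 (real_span (generators \<nu>0 \<mu>0 c)) \<and>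
        irreducible_subrep so32 (rho \<nu>0 \<mu>0 c) (sub_space \<nu>0 \<mu>0) \<and>
        (\<forall>X\<in>so32. skew_hermitian_on (sub_index \<nu>0 \<mu>0) (mat_entry (rho \<nu>0 \<mu>0 c X)))) \<and>
     (\<forall>v\<in>sub_space \<nu>0 \<mu>0.
        (\<forall>r \<theta> \<phi>. 0 < r \<and> 0 < \<theta> \<and> \<theta> < pi \<longrightarrow> realise \<nu>0 \<mu>0 v r \<theta> \<phi> = 0) \<longrightarrow> v = 0)"
proof -
  obtain \<delta> :: int where \<delta>: "\<delta> = 0 \<or> \<delta> = 1" and eq: "\<nu>0 = of_int \<delta> / 2" "\<mu>0 = of_int \<delta> / 2"
  proof
    show "(if \<nu>0 = 0 then 0 else 1 :: int) = 0 \<or> (if \<nu>0 = 0 then 0 else 1 :: int) = 1"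
      "\<nu>0 = of_int (if \<nu>0 = 0 then 0 else 1) / 2" "\<mu>0 = of_int (if \<nu>0 = 0 then 0 else 1) / 2"
      using assms by auto
  qed
  show ?thesis
    unfolding eq
  proof (intro conjI allI impI ballI)
    show "\<exists>c. admissible_roots (of_int \<delta> / 2) (of_int \<delta> / 2) c \<and> lie_rep so32 (rho (of_int \<delta> / 2) (of_int \<delta> / 2) c)"
      using admissible_factored_roots[OF \<delta>] lie_rep_factored_roots by blast
  next
    fix c
    assume "admissible_roots (of_int \<delta> / 2) (of_int \<delta> / 2) c \<and> lie_rep so32 (rho (of_int \<delta> / 2) (of_int \<delta> / 2) c)"
    then interpret ladder_roots \<delta> c
      using \<delta> by unfold_locales auto
    show "bij_betw rep so32 (real_span gens)" by (rule bij_rep)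
    show "irreducible_subrep so32 rep (sub_space (of_int \<delta> / 2) (of_int \<delta> / 2))" by (rule irreducible_rep)
    show "skew_hermitian_on index (mat_entry (rep X))" if "X \<in> so32" for X
      using that by (rule skew_hermitian_rep)
  next
    fix v
    assume "v \<in> sub_space (of_int \<delta> / 2) (of_int \<delta> / 2)"
      and "\<forall>r \<theta> \<phi>. 0 < r \<and> 0 < \<theta> \<and> \<theta> < pi \<longrightarrow> realise (of_int \<delta> / 2) (of_int \<delta> / 2) v r \<theta> \<phi> = 0"
    then show "v = 0"
      using realise_inject[OF \<delta>] unfolding sub_space_def span_bas_iff by blast
  qed
qed

end
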